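(* Let $\mathbb{A}$ be a PCA with elementary sub-PCA $\mathbb{A}'$, let $\mathfrak{M}\colon\mathsf{Set}^{\mathrm{op}}\to\mathsf{Pos}$ be the Medvedev doctrine and $\mathfrak{T}\colon\mathsf{Set}^{\mathrm{op}}\to\mathsf{Pos}$ the Turing doctrine. Then there is an isomorphism of full universal doctrines $$\mathfrak{M}\equiv\mathfrak{T}^{\forall_{\mathsf f}}$$ between $\mathfrak{M}$ and the full universal completion of $\mathfrak{T}$. In particular, for every set $X$, the map $(f,\alpha)\mapsto\alpha\circ f^{-1}$, which sends $f\colon Y\to X$ and $\alpha\colon Y\to\mathbb{A}$ to the function $x\mapsto\{\alpha(y): y\in Y,\ f(y)=x\}$, is a surjective (pre)order homomorphism from $(\mathfrak{T}^{\forall_{\mathsf f}}(X),\le_{\forall_{\mathsf f}})$ to $(\mathfrak{M}(X),\le_{\mathrm M})$.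
   Context: A partial combinatory algebra (PCA) is a set $\mathbb{A}$ with a partial binary operation $\cdot$ (application, associating to the left; $ab\downarrow$ means that $ab$ is defined; $x\simeq y$ means that $x$ is defined whenever $y$ is, in which case they are equal) for which there exist $k,s\in\mathbb{A}$ such that for all $a,b,c\in\mathbb{A}$: $ka\downarrow$, $kab\simeq a$, $sa\downarrow$, $sab\downarrow$, $sabc\simeq ac(bc)$. An elementary sub-PCA is a subset $\mathbb{A}'\subseteq\mathbb{A}$ closed under (defined) application that contains elements $k,s$ such that $ka\downarrow$, $kab\simeq a$, $sa\downarrow$, $sab\downarrow$ and $sabc\simeq ac(bc)$ for all $a,b,c\in\mathbb{A}$. A doctrine is a functor $P\colon\mathcal{C}^{\mathrm{op}}\to\mathsf{Pos}$ with $\mathcal{C}$ having finite products. It is full universal if for every morphism $f\colon X\to A$ of $\mathcal{C}$, $P_f$ has a right adjoint $\forall_f$, satisfying Beck-Chevalley ($\forall_{f'}P_{h'}=P_h\forall_f$ for every pullback square $fh'=hf'$). An isomorphism of doctrines on the same base is a natural family of poset isomorphisms; an isomorphism of full universal doctrines also commutes with the $\forall_f$. Full universal completion ($\mathcal{C}$ with pullbacks): $P^{\forall_{\mathsf f}}(A)$ is the poset reflection of the preorder of pairs $(f,\alpha)$ with $f\colon B\to A$ in $\mathcal{C}$ and $\alpha\in P(B)$, where $(f\colon B\to A,\alpha)\le_{\forall_{\mathsf f}}(g\colon C\to A,\beta)$ iff there is $h\colon C\to B$ with $f h=g$ and $P_h(\alpha)\le\beta$. For $u\colon A'\to A$, the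 action sends $(g\colon C\to A,\beta)$ to $(u^*g\colon D\to A',P_{g^*u}(\beta))$, where $D=A'\times_A C$ with projections $u^*g\colon D\to A'$ and $g^*u\colon D\to C$. Turing doctrine: $\mathfrak{T}(X)$ is (the poset reflection of) the set of functions $X\to\mathbb{A}$ preordered by $\alpha\le_{\mathsf T}\beta$ iff there is $\overline a\in\mathbb{A}'$ such that for every $x\in X$, $\overline a\cdot\beta(x)$ is defined and equals $\alpha(x)$; it acts on functions by precomposition. Medvedev doctrine: $\mathfrak{M}(X)$ is the poset reflection of the set of functions $X\to\wp(\mathbb{A})$ preordered by $\varphi\le_{\mathrm M}\psi$ iff there is $\overline a\in\mathbb{A}'$ such that for all $x\in X$ and $b\in\psi(x)$, $\overline a\cdot b$ is defined and lies in $\varphi(x)$; it acts on functions by precomposition. Equivalence classes are identified with representatives. *)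

theory Defs
  imports Main "HOL-Library.FuncSet" "HOL-Library.Equipollence"
begin

section \<open>Categories\<close>

record ('o, 'm) cat =
  obj :: "'o set"
  arr :: "'m set"
  source :: "'m \<Rightarrow> 'o"
  target :: "'m \<Rightarrow> 'o"
  idn :: "'o \<Rightarrow> 'm"
  cmp :: "'m \<Rightarrow> 'm \<Rightarrow> 'm"  \<comment> \<open>\<open>cmp C g f\<close> is \<open>g\<close> after \<open>f\<close>\<close>

definition hom :: "('o, 'm) cat \<Rightarrow> 'o \<Rightarrow> 'o \<Rightarrow> 'm set" where
  "hom C X Y = {f \<in> arr C. source C f = X \<and> target C f = Y}"

locale category =
  fixes C :: "('o, 'm) cat"
  assumes source_obj: "f \<in> arr C \<Longrightarrow> source C f \<in> obj C"
    and target_obj: "f \<in> arr C \<Longrightarrow> target C f \<in> obj C"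
    and idn_hom: "X \<in> obj C \<Longrightarrow> idn C X \<in> hom C X X"
    and cmp_hom: "f \<in> hom C X Y \<Longrightarrow> g \<in> hom C Y Z \<Longrightarrow> cmp C g f \<in> hom C X Z"
    and cmp_idn: "f \<in> hom C X Y \<Longrightarrow> cmp C f (idn C X) = f"
    and idn_cmp: "f \<in> hom C X Y \<Longrightarrow> cmp C (idn C Y) f = f"
    and cmp_assoc: "f \<in> hom C X Y \<Longrightarrow> g \<in> hom C Y Z \<Longrightarrow> h \<in> hom C Z W
          \<Longrightarrow> cmp C h (cmp C g f) = cmp C (cmp C h g) f"

definition has_finite_products :: "('o, 'm) cat \<Rightarrow> bool" where
  "has_finite_products C \<longleftrightarrow>
     (\<exists>T\<in>obj C. \<forall>X\<in>obj C. \<exists>!t. t \<in> hom C X T) \<and>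
     (\<forall>X\<in>obj C. \<forall>Y\<in>obj C. \<exists>Z\<in>obj C. \<exists>p\<in>hom C Z X. \<exists>q\<in>hom C Z Y.
        \<forall>W\<in>obj C. \<forall>f\<in>hom C W X. \<forall>g\<in>hom C W Y.
          \<exists>!h. h \<in> hom C W Z \<and> cmp C p h = f \<and> cmp C q h = g)"

text \<open>\<open>is_pullback C f g p q\<close>: the square \<open>f p = g q\<close> is a pullback, with \<open>p\<close> the projection to the
  source of \<open>f\<close> and \<open>q\<close> the projection to the source of \<open>g\<close>.\<close>

definition is_pullback :: "('o, 'm) cat \<Rightarrow> 'm \<Rightarrow> 'm \<Rightarrow> 'm \<Rightarrow> 'm \<Rightarrow> bool" where
  "is_pullback C f g p q \<longleftrightarrow>
     f \<in> arr C \<and> g \<in> arr C \<and> target C f = target C g \<and>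
     p \<in> arr C \<and> q \<in> arr C \<and> source C p = source C q \<and>
     target C p = source C f \<and> target C q = source C g \<and>
     cmp C f p = cmp C g q \<and>
     (\<forall>W\<in>obj C. \<forall>a\<in>hom C W (source C f). \<forall>b\<in>hom C W (source C g).
        cmp C f a = cmp C g b \<longrightarrow>
        (\<exists>!h. h \<in> hom C W (source C p) \<and> cmp C p h = a \<and> cmp C q h = b))"

section \<open>Doctrines\<close>

text \<open>The same record carries poset-valued and preorder-valued indexed structures on the objects of a
  category: \<open>elts\<close> and \<open>le\<close> are the fibres, and \<open>act P f\<close> maps the fibre over the target of \<open>f\<close> to the
  fibre over its source.\<close>

record ('o, 'm, 'p) indexed =
  elts :: "'o \<Rightarrow> 'p set"
  le :: "'o \<Rightarrow> ('p \<times> 'p) set"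
  act :: "'m \<Rightarrow> 'p \<Rightarrow> 'p"

locale doctrine = category C
  for C :: "('o, 'm) cat" +
  fixes P :: "('o, 'm, 'p) indexed"
  assumes finite_products: "has_finite_products C"
    and poset: "X \<in> obj C \<Longrightarrow> partial_order_on (elts P X) (le P X)"
    and act_elts: "f \<in> hom C X Y \<Longrightarrow> \<alpha> \<in> elts P Y \<Longrightarrow> act P f \<alpha> \<in> elts P X"
    and act_mono: "f \<in> hom C X Y \<Longrightarrow> (\<alpha>, \<beta>) \<in> le P Y \<Longrightarrow> (act P f \<alpha>, act P f \<beta>) \<in> le P X"
    and act_idn: "X \<in> obj C \<Longrightarrow> \<alpha> \<in> elts P X \<Longrightarrow> act P (idn C X) \<alpha> = \<alpha>"
    and act_cmp: "f \<in> hom C X Y \<Longrightarrow> g \<in> hom C Y Z \<Longrightarrow> \<alpha> \<in> elts P Z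
          \<Longrightarrow> act P (cmp C g f) \<alpha> = act P f (act P g \<alpha>)"

definition is_right_adjoint ::
  "('o, 'm) cat \<Rightarrow> ('o, 'm, 'p) indexed \<Rightarrow> 'm \<Rightarrow> ('p \<Rightarrow> 'p) \<Rightarrow> bool" where
  "is_right_adjoint C P f G \<longleftrightarrow>
     G \<in> elts P (source C f) \<rightarrow>\<^sub>E elts P (target C f) \<and>
     (\<forall>\<beta>\<in>elts P (target C f). \<forall>\<alpha>\<in>elts P (source C f).
        (act P f \<beta>, \<alpha>) \<in> le P (source C f) \<longleftrightarrow> (\<beta>, G \<alpha>) \<in> le P (target C f))"

definition univ :: "('o, 'm) cat \<Rightarrow> ('o, 'm, 'p) indexed \<Rightarrow> 'm \<Rightarrow> 'p \<Rightarrow> 'p" where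
  "univ C P f = (THE G. is_right_adjoint C P f G)"

locale full_universal_doctrine = doctrine +
  assumes right_adjoint: "f \<in> arr C \<Longrightarrow> \<exists>G. is_right_adjoint C P f G"
    and beck_chevalley: "is_pullback C f h h' f' \<Longrightarrow> \<alpha> \<in> elts P (source C f)
          \<Longrightarrow> univ C P f' (act P h' \<alpha>) = act P h (univ C P f \<alpha>)"

definition doctrine_iso ::
  "('o, 'm) cat \<Rightarrow> ('o, 'm, 'p) indexed \<Rightarrow> ('o, 'm, 'q) indexed \<Rightarrow> ('o \<Rightarrow> 'p \<Rightarrow> 'q) \<Rightarrow> bool" where
  "doctrine_iso C P Q \<theta> \<longleftrightarrow>
     doctrine C P \<and> doctrine C Q \<and>
     (\<forall>X\<in>obj C. bij_betw (\<theta> X) (elts P X) (elts Q X) \<and>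
        (\<forall>\<alpha>\<in>elts P X. \<forall>\<beta>\<in>elts P X. (\<alpha>, \<beta>) \<in> le P X \<longleftrightarrow> (\<theta> X \<alpha>, \<theta> X \<beta>) \<in> le Q X)) \<and>
     (\<forall>f\<in>arr C. \<forall>\<alpha>\<in>elts P (target C f).
        \<theta> (source C f) (act P f \<alpha>) = act Q f (\<theta> (target C f) \<alpha>))"

definition full_universal_iso ::
  "('o, 'm) cat \<Rightarrow> ('o, 'm, 'p) indexed \<Rightarrow> ('o, 'm, 'q) indexed \<Rightarrow> ('o \<Rightarrow> 'p \<Rightarrow> 'q) \<Rightarrow> bool" where
  "full_universal_iso C P Q \<theta> \<longleftrightarrow>
     full_universal_doctrine C P \<and> full_universal_doctrine C Q \<and> doctrine_iso C P Q \<theta> \<and>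
     (\<forall>f\<in>arr C. \<forall>\<alpha>\<in>elts P (source C f).
        \<theta> (target C f) (univ C P f \<alpha>) = univ C Q f (\<theta> (source C f) \<alpha>))"

section \<open>Poset reflection and full universal completion\<close>

definition equivalent :: "('o, 'm, 'p) indexed \<Rightarrow> 'o \<Rightarrow> ('p \<times> 'p) set" where
  "equivalent P X = le P X \<inter> (le P X)\<inverse>"

definition eclass :: "('o, 'm, 'p) indexed \<Rightarrow> 'o \<Rightarrow> 'p \<Rightarrow> 'p set" where
  "eclass P X x = equivalent P X `` {x}"

text \<open>In \<open>act\<close>, the union is the usual encoding of a function on equivalence classes: all members of
  the union are the same class.\<close>

definition poset_reflection ::
  "('o, 'm) cat \<Rightarrow> ('o, 'm, 'p) indexed \<Rightarrow> ('o, 'm, 'p set) indexed" where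
  "poset_reflection C P =
    \<lparr> elts = (\<lambda>X. elts P X // equivalent P X),
      le = (\<lambda>X. {(c, d). c \<in> elts P X // equivalent P X \<and> d \<in> elts P X // equivalent P X \<and>
                    (\<exists>x\<in>c. \<exists>y\<in>d. (x, y) \<in> le P X)}),
      act = (\<lambda>f c. \<Union>x\<in>c. eclass P (source C f) (act P f x)) \<rparr>"

text \<open>The completion at the level of pairs, before poset reflection. The category is assumed to have
  pullbacks; the action uses an arbitrarily chosen one.\<close>

definition completion_pre ::
  "('o, 'm) cat \<Rightarrow> ('o, 'm, 'p) indexed \<Rightarrow> ('o, 'm, 'm \<times> 'p) indexed" where
  "completion_pre C P =
    \<lparr> elts = (\<lambda>A. {(f, \<alpha>). f \<in> arr C \<and> target C f = A \<and> \<alpha> \<in> elts P (source C f)}),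
      le = (\<lambda>A. {((f, \<alpha>), (g, \<beta>)).
                  f \<in> arr C \<and> target C f = A \<and> \<alpha> \<in> elts P (source C f) \<and>
                  g \<in> arr C \<and> target C g = A \<and> \<beta> \<in> elts P (source C g) \<and>
                  (\<exists>h\<in>hom C (source C g) (source C f).
                     cmp C f h = g \<and> (act P h \<alpha>, \<beta>) \<in> le P (source C g))}),
      act = (\<lambda>u (g, \<beta>). let (p, q) = (SOME (p, q). is_pullback C u g p q) in (p, act P q \<beta>)) \<rparr>"

definition completion ::
  "('o, 'm) cat \<Rightarrow> ('o, 'm, 'p) indexed \<Rightarrow> ('o, 'm, ('m \<times> 'p) set) indexed" where
  "completion C P = poset_reflection C (completion_pre C P)"

section \<open>The category of sets\<close>

text \<open>HOL has no type of all sets, so the category of sets is taken relative to a collection \<open>U\<close> of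
  small sets. Only closure under subsets and (up to bijection) binary products is required. Every
  Grothendieck universe satisfies this, and the small sets of a model of ZFC give the category of sets
  itself. The powerset of an object need not be an object.\<close>

locale set_universe =
  fixes U :: "'u set set"
  assumes subset_closed: "X \<in> U \<Longrightarrow> Y \<subseteq> X \<Longrightarrow> Y \<in> U"
    and product_closed: "X \<in> U \<Longrightarrow> Y \<in> U \<Longrightarrow> \<exists>Z\<in>U. Z \<approx> X \<times> Y"
    and nontrivial: "\<exists>X\<in>U. X \<noteq> {}"

type_synonym 'u setmap = "'u set \<times> ('u \<Rightarrow> 'u) \<times> 'u set"

definition Sets :: "'u set set \<Rightarrow> ('u set, 'u setmap) cat" where
  "Sets U =
    \<lparr> obj = U,
      arr = {(X, f, Y). X \<in> U \<and> Y \<in> U \<and> f \<in> X \<rightarrow>\<^sub>E Y},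
      source = (\<lambda>(X, f, Y). X),
      target = (\<lambda>(X, f, Y). Y),
      idn = (\<lambda>X. (X, \<lambda>x\<in>X. x, X)),
      cmp = (\<lambda>(Y, g, Z) (X, f, Y'). (X, compose X g f, Z)) \<rparr>"

section \<open>Partial combinatory algebras\<close>

text \<open>Application is a partial operation on a carrier set; terms that may be undefined are of option
  type, \<open>None\<close> meaning undefined.\<close>

definition app_term :: "('u \<Rightarrow> 'u \<Rightarrow> 'u option) \<Rightarrow> 'u option \<Rightarrow> 'u option \<Rightarrow> 'u option" where
  "app_term app s t = Option.bind s (\<lambda>a. Option.bind t (\<lambda>b. app a b))"

text \<open>\<open>x \<simeq> y\<close> in the directed sense: \<open>x\<close> is defined whenever \<open>y\<close> is, and they are then equal.\<close>

definition directed_eq :: "'u option \<Rightarrow> 'u option \<Rightarrow> bool" where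
  "directed_eq s t \<longleftrightarrow> (t \<noteq> None \<longrightarrow> s = t)"

definition is_k :: "'u set \<Rightarrow> ('u \<Rightarrow> 'u \<Rightarrow> 'u option) \<Rightarrow> 'u \<Rightarrow> bool" where
  "is_k A app k \<longleftrightarrow>
     (\<forall>a\<in>A. \<forall>b\<in>A. app k a \<noteq> None \<and>
        directed_eq (app_term app (app k a) (Some b)) (Some a))"

definition is_s :: "'u set \<Rightarrow> ('u \<Rightarrow> 'u \<Rightarrow> 'u option) \<Rightarrow> 'u \<Rightarrow> bool" where
  "is_s A app s \<longleftrightarrow>
     (\<forall>a\<in>A. \<forall>b\<in>A. \<forall>c\<in>A. app s a \<noteq> None \<and>
        app_term app (app s a) (Some b) \<noteq> None \<and>
        directed_eq (app_term app (app_term app (app s a) (Some b)) (Some c))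
                    (app_term app (app a c) (app b c)))"

locale pca =
  fixes A :: "'u set" and app :: "'u \<Rightarrow> 'u \<Rightarrow> 'u option"
  assumes app_closed: "a \<in> A \<Longrightarrow> b \<in> A \<Longrightarrow> app a b = Some c \<Longrightarrow> c \<in> A"
    and combinators: "\<exists>k\<in>A. \<exists>s\<in>A. is_k A app k \<and> is_s A app s"

locale elementary_sub_pca = pca +
  fixes A' :: "'u set"
  assumes sub_carrier: "A' \<subseteq> A"
    and sub_app_closed: "a \<in> A' \<Longrightarrow> b \<in> A' \<Longrightarrow> app a b = Some c \<Longrightarrow> c \<in> A'"
    and sub_combinators: "\<exists>k\<in>A'. \<exists>s\<in>A'. is_k A app k \<and> is_s A app s"

section \<open>The Turing and Medvedev doctrines\<close>

definition turing_pre ::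
  "'u set \<Rightarrow> ('u \<Rightarrow> 'u \<Rightarrow> 'u option) \<Rightarrow> 'u set \<Rightarrow> ('u set, 'u setmap, 'u \<Rightarrow> 'u) indexed" where
  "turing_pre A app A' =
    \<lparr> elts = (\<lambda>X. X \<rightarrow>\<^sub>E A),
      le = (\<lambda>X. {(\<alpha>, \<beta>). \<alpha> \<in> X \<rightarrow>\<^sub>E A \<and> \<beta> \<in> X \<rightarrow>\<^sub>E A \<and>
                    (\<exists>a\<in>A'. \<forall>x\<in>X. app a (\<beta> x) = Some (\<alpha> x))}),
      act = (\<lambda>(X, f, Y) \<alpha>. compose X \<alpha> f) \<rparr>"

definition turing where
  "turing U A app A' = poset_reflection (Sets U) (turing_pre A app A')"

definition medvedev_pre ::
  "'u set \<Rightarrow> ('u \<Rightarrow> 'u \<Rightarrow> 'u option) \<Rightarrow> 'u set \<Rightarrow> ('u set, 'u setmap, 'u \<Rightarrow> 'u set) indexed" where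
  "medvedev_pre A app A' =
    \<lparr> elts = (\<lambda>X. X \<rightarrow>\<^sub>E Pow A),
      le = (\<lambda>X. {(\<phi>, \<psi>). \<phi> \<in> X \<rightarrow>\<^sub>E Pow A \<and> \<psi> \<in> X \<rightarrow>\<^sub>E Pow A \<and>
                    (\<exists>a\<in>A'. \<forall>x\<in>X. \<forall>b\<in>\<psi> x. \<exists>c\<in>\<phi> x. app a b = Some c)}),
      act = (\<lambda>(X, f, Y) \<phi>. compose X \<phi> f) \<rparr>"

definition medvedev where
  "medvedev U A app A' = poset_reflection (Sets U) (medvedev_pre A app A')"

text \<open>The function \<open>\<alpha> \<circ> f\<^sup>-\<^sup>1\<close>, for \<open>f\<close> a map from \<open>Y\<close> to \<open>X\<close>.\<close>

fun fibre_values :: "'u setmap \<times> ('u \<Rightarrow> 'u) \<Rightarrow> 'u \<Rightarrow> 'u set" where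
  "fibre_values ((Y, f, X), \<alpha>) = (\<lambda>x\<in>X. {\<alpha> y | y. y \<in> Y \<and> f y = x})"

end

theory Submission
  imports Defs
begin

text \<open>A realizer of \<open>\<alpha> \<circ> f\<^sup>-\<^sup>1 \<le> \<beta> \<circ> g\<^sup>-\<^sup>1\<close> in the Medvedev preorder sends each \<open>\<beta> z\<close> to some \<open>\<alpha> y\<close> with
  \<open>f y = g z\<close>; choosing such a \<open>y\<close> for every \<open>z\<close> gives exactly a map \<open>h\<close> with \<open>f h = g\<close> and
  \<open>\<alpha> \<circ> h \<le> \<beta>\<close> in the Turing preorder. So \<open>(f, \<alpha>) \<mapsto> \<alpha> \<circ> f\<^sup>-\<^sup>1\<close> preserves and reflects the order. It is onto,
  since \<open>\<phi>\<close> is the image of the two projections of \<open>{(x, a). a \<in> \<phi> x}\<close>, and it commutes with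
  reindexing because a pullback square identifies fibres. The right adjoint to reindexing along \<open>f\<close> in
  the Medvedev doctrine is union over the fibres of \<open>f\<close>; right adjoints being unique, they and the
  Beck--Chevalley condition transfer along the isomorphism.\<close>

section \<open>Poset reflections of preordered doctrines\<close>

text \<open>Functoriality is asked for only up to equivalence: reindexing in the completion goes
  through a chosen pullback, so it need not be strict before passing to classes.\<close>

locale pre_doctrine = category C
  for C :: "('o, 'm) cat" +
  fixes P :: "('o, 'm, 'p) indexed"
  assumes finite_products: "has_finite_products C"
    and le_elts: "X \<in> obj C \<Longrightarrow> (\<alpha>, \<beta>) \<in> le P X \<Longrightarrow> \<alpha> \<in> elts P X \<and> \<beta> \<in> elts P X"
    and le_refl: "X \<in> obj C \<Longrightarrow> \<alpha> \<in> elts P X \<Longrightarrow> (\<alpha>, \<alpha>) \<in> le P X"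
    and le_trans: "X \<in> obj C \<Longrightarrow> (\<alpha>, \<beta>) \<in> le P X \<Longrightarrow> (\<beta>, \<gamma>) \<in> le P X \<Longrightarrow> (\<alpha>, \<gamma>) \<in> le P X"
    and act_elts: "f \<in> hom C X Y \<Longrightarrow> \<alpha> \<in> elts P Y \<Longrightarrow> act P f \<alpha> \<in> elts P X"
    and act_mono: "f \<in> hom C X Y \<Longrightarrow> (\<alpha>, \<beta>) \<in> le P Y \<Longrightarrow> (act P f \<alpha>, act P f \<beta>) \<in> le P X"
    and act_idn: "X \<in> obj C \<Longrightarrow> \<alpha> \<in> elts P X \<Longrightarrow> (act P (idn C X) \<alpha>, \<alpha>) \<in> equivalent P X"
    and act_cmp: "f \<in> hom C X Y \<Longrightarrow> g \<in> hom C Y Z \<Longrightarrow> \<alpha> \<in> elts P Z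
          \<Longrightarrow> (act P (cmp C g f) \<alpha>, act P f (act P g \<alpha>)) \<in> equivalent P X"
begin

lemma hom_obj: "f \<in> hom C X Y \<Longrightarrow> X \<in> obj C \<and> Y \<in> obj C"
  using source_obj target_obj unfolding hom_def by blast

lemma equivalent_iff: "(\<alpha>, \<beta>) \<in> equivalent P X \<longleftrightarrow> (\<alpha>, \<beta>) \<in> le P X \<and> (\<beta>, \<alpha>) \<in> le P X"
  by (auto simp: equivalent_def)

lemma equiv_equivalent: "X \<in> obj C \<Longrightarrow> equiv (elts P X) (equivalent P X)"
  by (rule equivI)
     (auto simp: equivalent_iff refl_on_def sym_def trans_def dest: le_elts le_refl intro: le_trans)

lemma eclass_eq_iff:
  "X \<in> obj C \<Longrightarrow> \<alpha> \<in> elts P X \<Longrightarrow> \<beta> \<in> elts P X \<Longrightarrow>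
    eclass P X \<alpha> = eclass P X \<beta> \<longleftrightarrow> (\<alpha>, \<beta>) \<in> equivalent P X"
  unfolding eclass_def by (meson eq_equiv_class_iff equiv_equivalent)

lemma eclass_eq: "X \<in> obj C \<Longrightarrow> (\<alpha>, \<beta>) \<in> equivalent P X \<Longrightarrow> eclass P X \<alpha> = eclass P X \<beta>"
  unfolding eclass_def by (meson equiv_class_eq equiv_equivalent)

lemma reflection_elts: "elts (poset_reflection C P) X = eclass P X ` elts P X"
  by (auto simp: poset_reflection_def quotient_def eclass_def)

lemma in_eclass_iff: "\<beta> \<in> eclass P X \<alpha> \<longleftrightarrow> (\<alpha>, \<beta>) \<in> equivalent P X"
  by (simp add: eclass_def)

text \<open>The order on classes only asks for some related pair of representatives; transitivity
  carries such a pair to any other choice.\<close>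

lemma reflection_le_iff:
  assumes X: "X \<in> obj C" and \<alpha>: "\<alpha> \<in> elts P X" and \<beta>: "\<beta> \<in> elts P X"
  shows "(eclass P X \<alpha>, eclass P X \<beta>) \<in> le (poset_reflection C P) X \<longleftrightarrow> (\<alpha>, \<beta>) \<in> le P X"
proof -
  have "eclass P X \<alpha> \<in> elts P X // equivalent P X" "eclass P X \<beta> \<in> elts P X // equivalent P X"
    using \<alpha> \<beta> by (auto simp: eclass_def intro: quotientI)
  then have "(eclass P X \<alpha>, eclass P X \<beta>) \<in> le (poset_reflection C P) X \<longleftrightarrow>
      (\<exists>x\<in>eclass P X \<alpha>. \<exists>y\<in>eclass P X \<beta>. (x, y) \<in> le P X)"
    by (simp add: poset_reflection_def)
  also have "\<dots> \<longleftrightarrow> (\<alpha>, \<beta>) \<in> le P X"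
    unfolding Bex_def in_eclass_iff equivalent_iff
    using le_trans[OF X] le_refl[OF X] \<alpha> \<beta> by blast
  finally show ?thesis .
qed

lemma reflection_le_elts:
  "(c, d) \<in> le (poset_reflection C P) X \<Longrightarrow>
     c \<in> elts (poset_reflection C P) X \<and> d \<in> elts (poset_reflection C P) X"
  by (auto simp: poset_reflection_def)

text \<open>Monotonicity of reindexing makes all members of the union the same class, and the union
  is over a nonempty set because \<alpha> lies in its own class.\<close>

lemma reflection_act:
  assumes f: "f \<in> hom C X Y" and \<alpha>: "\<alpha> \<in> elts P Y"
  shows "act (poset_reflection C P) f (eclass P Y \<alpha>) = eclass P X (act P f \<alpha>)"
proof -
  have X: "X \<in> obj C" and Y: "Y \<in> obj C" and src: "source C f = X"
    using hom_obj[OF f] f by (auto simp: hom_def)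
  have "eclass P X (act P f x) = eclass P X (act P f \<alpha>)" if "x \<in> eclass P Y \<alpha>" for x
    by (rule eclass_eq[OF X]) (use that act_mono[OF f] in \<open>auto simp: in_eclass_iff equivalent_iff\<close>)
  moreover have "\<alpha> \<in> eclass P Y \<alpha>"
    using le_refl[OF Y \<alpha>] by (simp add: in_eclass_iff equivalent_iff)
  ultimately show ?thesis
    unfolding poset_reflection_def src indexed.simps by blast
qed

text \<open>Every law is checked on representatives. Antisymmetry and strict functoriality appear
  because equivalent elements have equal classes.\<close>

lemma doctrine_reflection: "doctrine C (poset_reflection C P)"
proof (intro doctrine.intro doctrine_axioms.intro)
  show "category C" by (rule category_axioms)
  show "has_finite_products C" by (rule finite_products)
next
  fix X assume X: "X \<in> obj C"
  note le_iff = reflection_le_iff[OF X]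
  have "c = d" if cd: "(c, d) \<in> le (poset_reflection C P) X" "(d, c) \<in> le (poset_reflection C P) X" for c d
  proof -
    obtain \<alpha> \<beta> where \<alpha>: "\<alpha> \<in> elts P X" "c = eclass P X \<alpha>"
      and \<beta>: "\<beta> \<in> elts P X" "d = eclass P X \<beta>"
      using reflection_le_elts[OF cd(1)] unfolding reflection_elts by (elim conjE imageE) blast
    with cd have "(\<alpha>, \<beta>) \<in> equivalent P X" by (simp add: le_iff equivalent_iff)
    then show ?thesis using eclass_eq[OF X] \<alpha> \<beta> by simp
  qed
  moreover have "(c, e) \<in> le (poset_reflection C P) X"
    if cd: "(c, d) \<in> le (poset_reflection C P) X" "(d, e) \<in> le (poset_reflection C P) X" for c d e
  proof -
    obtain \<alpha> \<beta> \<gamma> where \<alpha>: "\<alpha> \<in> elts P X" "c = eclass P X \<alpha>"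
      and \<beta>: "\<beta> \<in> elts P X" "d = eclass P X \<beta>" and \<gamma>: "\<gamma> \<in> elts P X" "e = eclass P X \<gamma>"
      using reflection_le_elts[OF cd(1)] reflection_le_elts[OF cd(2)]
      unfolding reflection_elts by (elim conjE imageE) blast
    with cd have "(\<alpha>, \<beta>) \<in> le P X" "(\<beta>, \<gamma>) \<in> le P X" by (simp_all add: le_iff)
    then show ?thesis using le_trans[OF X] \<alpha> \<gamma> by (simp add: le_iff)
  qed
  moreover have "(c, c) \<in> le (poset_reflection C P) X" if "c \<in> elts (poset_reflection C P) X" for c
    using that le_iff le_refl[OF X] by (auto simp: reflection_elts)
  ultimately show "partial_order_on (elts (poset_reflection C P) X) (le (poset_reflection C P) X)"
    unfolding partial_order_on_def preorder_on_def refl_on_def antisym_def trans_def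
    by (intro conjI allI impI ballI subrelI SigmaI) (use reflection_le_elts in blast)+
next
  fix f X Y c assume f: "f \<in> hom C X Y" and "c \<in> elts (poset_reflection C P) Y"
  then show "act (poset_reflection C P) f c \<in> elts (poset_reflection C P) X"
    using reflection_act[OF f] act_elts[OF f] by (auto simp: reflection_elts)
next
  fix f X Y c d assume f: "f \<in> hom C X Y" and cd: "(c, d) \<in> le (poset_reflection C P) Y"
  then obtain \<alpha> \<beta> where "\<alpha> \<in> elts P Y" "\<beta> \<in> elts P Y" "c = eclass P Y \<alpha>" "d = eclass P Y \<beta>"
    using reflection_le_elts[OF cd] by (auto simp: reflection_elts)
  then show "(act (poset_reflection C P) f c, act (poset_reflection C P) f d)
      \<in> le (poset_reflection C P) X"
    using cd f hom_obj[OF f] by (simp add: reflection_act reflection_le_iff act_elts act_mono)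
next
  fix X c assume X: "X \<in> obj C" and "c \<in> elts (poset_reflection C P) X"
  then show "act (poset_reflection C P) (idn C X) c = c"
    using eclass_eq[OF X act_idn[OF X]] reflection_act[OF idn_hom[OF X]] by (auto simp: reflection_elts)
next
  fix f X Y g Z c assume f: "f \<in> hom C X Y" and g: "g \<in> hom C Y Z"
    and "c \<in> elts (poset_reflection C P) Z"
  then show "act (poset_reflection C P) (cmp C g f) c =
      act (poset_reflection C P) f (act (poset_reflection C P) g c)"
    using eclass_eq[OF _ act_cmp[OF f g]] hom_obj[OF f] cmp_hom[OF f g]
    by (auto simp: reflection_elts reflection_act act_elts)
qed

end

section \<open>Right adjoints\<close>

context doctrine
begin

text \<open>Since \<open>univ\<close> is a definite description, it is usable only once adjoints are
  unique. Inside the fibre antisymmetry gives equality; outside it both functions are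
  extensional.\<close>

lemma right_adjoint_unique:
  assumes f: "f \<in> arr C" and G: "is_right_adjoint C P f G" and H: "is_right_adjoint C P f H"
  shows "G = H"
proof (rule extensionalityI)
  show "G \<in> extensional (elts P (source C f))" "H \<in> extensional (elts P (source C f))"
    using G H by (auto simp: is_right_adjoint_def PiE_def)
next
  fix \<alpha> assume \<alpha>: "\<alpha> \<in> elts P (source C f)"
  have po: "partial_order_on (elts P (target C f)) (le P (target C f))"
    using poset target_obj f by blast
  have "G \<alpha> \<in> elts P (target C f)" "H \<alpha> \<in> elts P (target C f)"
    using G H \<alpha> by (auto simp: is_right_adjoint_def)
  \<comment> \<open>Reflexivity at \<open>G \<alpha>\<close> gives the counit of \<open>G\<close>,
    namely that reindexing \<open>G \<alpha>\<close> along \<open>f\<close> lands below \<alpha>;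
    the adjunction for \<open>H\<close> transposes it. The other inequality is symmetric.\<close>
  moreover from this have "(G \<alpha>, H \<alpha>) \<in> le P (target C f)" "(H \<alpha>, G \<alpha>) \<in> le P (target C f)"
    using G H \<alpha> po unfolding is_right_adjoint_def partial_order_on_def preorder_on_def refl_on_def
    by blast+
  ultimately show "G \<alpha> = H \<alpha>"
    using po by (auto simp: partial_order_on_def antisym_def)
qed

lemma univ_eqI: "f \<in> arr C \<Longrightarrow> is_right_adjoint C P f G \<Longrightarrow> univ C P f = G"
  unfolding univ_def by (blast intro: right_adjoint_unique)

end

text \<open>A candidate adjoint given on representatives descends to classes: the adjunction alone
  forces it to be monotone, hence compatible with equivalence, and Beck-Chevalley up to equivalence
  becomes an equation.\<close>

lemma (in pre_doctrine) full_universal_reflection: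
  fixes G :: "'m \<Rightarrow> 'p \<Rightarrow> 'p"
  assumes G_elts: "\<And>f X Y \<alpha>. f \<in> hom C X Y \<Longrightarrow> \<alpha> \<in> elts P X \<Longrightarrow> G f \<alpha> \<in> elts P Y"
    and adj: "\<And>f X Y \<alpha> \<beta>. f \<in> hom C X Y \<Longrightarrow> \<alpha> \<in> elts P X \<Longrightarrow> \<beta> \<in> elts P Y \<Longrightarrow>
        (act P f \<beta>, \<alpha>) \<in> le P X \<longleftrightarrow> (\<beta>, G f \<alpha>) \<in> le P Y"
    and bc: "\<And>f h h' f' \<alpha>. is_pullback C f h h' f' \<Longrightarrow> \<alpha> \<in> elts P (source C f) \<Longrightarrow>
        (G f' (act P h' \<alpha>), act P h (G f \<alpha>)) \<in> equivalent P (source C h)"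
  shows "full_universal_doctrine C (poset_reflection C P)"
proof -
  let ?R = "poset_reflection C P"
  interpret R: doctrine C ?R by (rule doctrine_reflection)
  have mono: "(G f \<alpha>, G f \<beta>) \<in> le P Y" if f: "f \<in> hom C X Y" and ab: "(\<alpha>, \<beta>) \<in> le P X" for f X Y \<alpha> \<beta>
  proof -
    have X: "X \<in> obj C" and Y: "Y \<in> obj C" using hom_obj[OF f] by auto
    have \<alpha>: "\<alpha> \<in> elts P X" and \<beta>: "\<beta> \<in> elts P X" using le_elts[OF X ab] by auto
    have "(act P f (G f \<alpha>), \<alpha>) \<in> le P X"
      using adj[OF f \<alpha> G_elts[OF f \<alpha>]] le_refl[OF Y G_elts[OF f \<alpha>]] by simp
    from le_trans[OF X this ab] show ?thesis
      using adj[OF f \<beta> G_elts[OF f \<alpha>]] by simp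
  qed
  \<comment> \<open>\<open>H\<close> applies \<open>G\<close> to an arbitrary representative, which
    by \<open>mono\<close> affects the result only up to equivalence. The restriction to the fibre
    makes \<open>H f\<close> extensional, as \<open>is_right_adjoint\<close> demands.\<close>
  define H where "H f = (\<lambda>c\<in>elts ?R (source C f).
      eclass P (target C f) (G f (SOME \<alpha>. \<alpha> \<in> elts P (source C f) \<and> c = eclass P (source C f) \<alpha>)))" for f
  have H: "H f (eclass P X \<alpha>) = eclass P Y (G f \<alpha>)" if f: "f \<in> hom C X Y" and \<alpha>: "\<alpha> \<in> elts P X" for f X Y \<alpha>
  proof -
    have X: "X \<in> obj C" and Y: "Y \<in> obj C" and st: "source C f = X" "target C f = Y"
      using hom_obj[OF f] f by (auto simp: hom_def)
    define \<beta> where "\<beta> = (SOME \<beta>. \<beta> \<in> elts P X \<and> eclass P X \<alpha> = eclass P X \<beta>)"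
    have \<beta>: "\<beta> \<in> elts P X \<and> eclass P X \<alpha> = eclass P X \<beta>"
      unfolding \<beta>_def by (rule someI[of _ \<alpha>]) (simp add: \<alpha>)
    then have "(\<alpha>, \<beta>) \<in> equivalent P X" using eclass_eq_iff[OF X \<alpha>] by blast
    then have "(G f \<alpha>, G f \<beta>) \<in> equivalent P Y" by (simp add: equivalent_iff mono[OF f])
    then show ?thesis
      using \<alpha> eclass_eq[OF Y] by (simp add: H_def st \<beta>_def reflection_elts)
  qed
  have H_adj: "is_right_adjoint C ?R f (H f)" if "f \<in> arr C" for f
  proof -
    obtain X Y where f: "f \<in> hom C X Y" and st: "source C f = X" "target C f = Y"
      using \<open>f \<in> arr C\<close> by (auto simp: hom_def)
    have X: "X \<in> obj C" and Y: "Y \<in> obj C" using hom_obj[OF f] by auto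
    have "H f \<in> elts ?R X \<rightarrow>\<^sub>E elts ?R Y"
    proof (rule PiE_I)
      fix c assume "c \<in> elts ?R X"
      then show "H f c \<in> elts ?R Y" using H[OF f] G_elts[OF f] by (auto simp: reflection_elts)
    qed (simp add: H_def st)
    then show ?thesis
      unfolding is_right_adjoint_def st
      using adj[OF f] H[OF f] G_elts[OF f]
      by (auto simp: reflection_elts reflection_act[OF f] reflection_le_iff X Y act_elts[OF f])
  qed
  show ?thesis
  proof (intro full_universal_doctrine.intro full_universal_doctrine_axioms.intro)
    show "doctrine C ?R" by (rule doctrine_reflection)
    show "\<exists>G. is_right_adjoint C ?R f G" if "f \<in> arr C" for f using H_adj[OF that] by blast
  next
    fix f h h' f' c
    assume pb: "is_pullback C f h h' f'" and c: "c \<in> elts ?R (source C f)"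
    then obtain \<alpha> where \<alpha>: "\<alpha> \<in> elts P (source C f)" and c: "c = eclass P (source C f) \<alpha>"
      by (auto simp: reflection_elts)
    have f: "f \<in> hom C (source C f) (target C f)" and h: "h \<in> hom C (source C h) (target C f)"
      and h': "h' \<in> hom C (source C h') (source C f)" and f': "f' \<in> hom C (source C h') (source C h)"
      using pb by (auto simp: is_pullback_def hom_def)
    \<comment> \<open>Uniqueness of adjoints identifies \<open>univ\<close> with the explicit
      \<open>H\<close>, so Beck-Chevalley can be computed on representatives.\<close>
    then have "univ C ?R f = H f" "univ C ?R f' = H f'"
      by (auto intro!: R.univ_eqI H_adj simp: hom_def)
    then show "univ C ?R f' (act ?R h' c) = act ?R h (univ C ?R f c)"
      using \<alpha> eclass_eq[OF _ bc[OF pb \<alpha>]] hom_obj[OF h]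
      by (simp add: c reflection_act[OF h'] reflection_act[OF h] H[OF f] H[OF f'] act_elts[OF h'] G_elts[OF f])
  qed
qed

text \<open>Conjugating the quantifiers of \<open>Q\<close> by \<theta> yields right adjoints in
  \<open>P\<close>. By uniqueness these are the quantifiers of \<open>P\<close>, so \<theta>
  commutes with quantification by construction.\<close>

lemma full_universal_iso_transfer:
  assumes Q: "full_universal_doctrine C Q" and iso: "doctrine_iso C P Q \<theta>"
  shows "full_universal_iso C P Q \<theta>"
proof -
  interpret Q: full_universal_doctrine C Q by (rule Q)
  interpret P: doctrine C P using iso by (simp add: doctrine_iso_def)
  have bij: "bij_betw (\<theta> X) (elts P X) (elts Q X)" if "X \<in> obj C" for X
    using iso that by (simp add: doctrine_iso_def)
  have le_iff: "(\<alpha>, \<beta>) \<in> le P X \<longleftrightarrow> (\<theta> X \<alpha>, \<theta> X \<beta>) \<in> le Q X"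
    if "X \<in> obj C" "\<alpha> \<in> elts P X" "\<beta> \<in> elts P X" for X \<alpha> \<beta>
    using iso that by (simp add: doctrine_iso_def)
  have nat: "\<theta> (source C f) (act P f \<alpha>) = act Q f (\<theta> (target C f) \<alpha>)"
    if "f \<in> arr C" "\<alpha> \<in> elts P (target C f)" for f \<alpha>
    using iso that by (simp add: doctrine_iso_def)
  have \<theta>_in: "\<theta> X \<alpha> \<in> elts Q X" if "X \<in> obj C" "\<alpha> \<in> elts P X" for X \<alpha>
    using bij_betwE[OF bij] that by blast
  have adjQ: "is_right_adjoint C Q f (univ C Q f)" if "f \<in> arr C" for f
    using Q.right_adjoint[OF that] Q.univ_eqI[OF that] by auto
  have univQ_in: "univ C Q f \<alpha> \<in> elts Q (target C f)"
    if "f \<in> arr C" "\<alpha> \<in> elts Q (source C f)" for f \<alpha>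
    using adjQ[OF that(1)] that(2) by (auto simp: is_right_adjoint_def)
  define G where "G f = (\<lambda>\<alpha>\<in>elts P (source C f).
      inv_into (elts P (target C f)) (\<theta> (target C f)) (univ C Q f (\<theta> (source C f) \<alpha>)))" for f
  have G: "G f \<alpha> \<in> elts P (target C f) \<and> \<theta> (target C f) (G f \<alpha>) = univ C Q f (\<theta> (source C f) \<alpha>)"
    if f: "f \<in> arr C" and \<alpha>: "\<alpha> \<in> elts P (source C f)" for f \<alpha>
  proof -
    have "univ C Q f (\<theta> (source C f) \<alpha>) \<in> \<theta> (target C f) ` elts P (target C f)"
      using univQ_in[OF f] \<theta>_in[OF Q.source_obj[OF f] \<alpha>] bij[OF Q.target_obj[OF f]]
      by (simp add: bij_betw_def)
    then show ?thesis using \<alpha> by (simp add: G_def inv_into_into f_inv_into_f)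
  qed
  have G_adj: "is_right_adjoint C P f (G f)" if f: "f \<in> arr C" for f
    unfolding is_right_adjoint_def
  proof (intro conjI ballI)
    show "G f \<in> elts P (source C f) \<rightarrow>\<^sub>E elts P (target C f)"
      using G[OF f] by (intro PiE_I) (auto simp: G_def)
  next
    fix \<beta> \<alpha> assume \<beta>: "\<beta> \<in> elts P (target C f)" and \<alpha>: "\<alpha> \<in> elts P (source C f)"
    note s = Q.source_obj[OF f] and t = Q.target_obj[OF f]
    have "act P f \<beta> \<in> elts P (source C f)" using f \<beta> by (auto intro: P.act_elts simp: hom_def)
    then have "(act P f \<beta>, \<alpha>) \<in> le P (source C f) \<longleftrightarrow>
        (act Q f (\<theta> (target C f) \<beta>), \<theta> (source C f) \<alpha>) \<in> le Q (source C f)"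
      by (simp add: le_iff[OF s _ \<alpha>] nat[OF f \<beta>])
    also have "\<dots> \<longleftrightarrow> (\<theta> (target C f) \<beta>, univ C Q f (\<theta> (source C f) \<alpha>)) \<in> le Q (target C f)"
      using adjQ[OF f] \<theta>_in[OF s \<alpha>] \<theta>_in[OF t \<beta>] by (simp add: is_right_adjoint_def)
    also have "\<dots> \<longleftrightarrow> (\<beta>, G f \<alpha>) \<in> le P (target C f)"
      using G[OF f \<alpha>] le_iff[OF t \<beta>] by simp
    finally show "(act P f \<beta>, \<alpha>) \<in> le P (source C f) \<longleftrightarrow> (\<beta>, G f \<alpha>) \<in> le P (target C f)" .
  qed
  have univP: "univ C P f = G f" if "f \<in> arr C" for f
    using P.univ_eqI[OF that G_adj[OF that]] .
  have "full_universal_doctrine C P"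
  proof (intro full_universal_doctrine.intro full_universal_doctrine_axioms.intro)
    show "doctrine C P" by (rule P.doctrine_axioms)
    show "\<exists>G. is_right_adjoint C P f G" if "f \<in> arr C" for f using G_adj[OF that] by blast
  next
    fix f h h' f' \<alpha>
    assume pb: "is_pullback C f h h' f'" and \<alpha>: "\<alpha> \<in> elts P (source C f)"
    have f: "f \<in> arr C" and h: "h \<in> arr C" and h': "h' \<in> arr C" and f': "f' \<in> arr C"
      and eqs: "target C h = target C f" "source C f' = source C h'" "target C h' = source C f"
        "target C f' = source C h"
      using pb by (auto simp: is_pullback_def)
    have h'\<alpha>: "act P h' \<alpha> \<in> elts P (source C f')"
      using \<alpha> h' eqs by (auto intro: P.act_elts simp: hom_def)
    have hG: "act P h (G f \<alpha>) \<in> elts P (source C h)"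
      using G[OF f \<alpha>] h eqs by (auto intro: P.act_elts simp: hom_def)
    \<comment> \<open>Both sides of Beck-Chevalley in \<open>P\<close> are compared after applying
      \<theta>, which is injective on the fibre over the source of \<open>h\<close>.\<close>
    have "\<theta> (source C h) (G f' (act P h' \<alpha>)) = univ C Q f' (act Q h' (\<theta> (source C f) \<alpha>))"
      using G[OF f' h'\<alpha>] nat[OF h'] \<alpha> eqs by simp
    also have "\<dots> = act Q h (univ C Q f (\<theta> (source C f) \<alpha>))"
      using Q.beck_chevalley[OF pb] \<theta>_in[OF Q.source_obj[OF f] \<alpha>] .
    also have "\<dots> = \<theta> (source C h) (act P h (G f \<alpha>))"
      using G[OF f \<alpha>] nat[OF h] eqs by simp
    finally have "G f' (act P h' \<alpha>) = act P h (G f \<alpha>)"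
      by (rule inj_onD[OF bij_betw_imp_inj_on[OF bij[OF Q.source_obj[OF h]]]])
         (use G[OF f' h'\<alpha>] hG eqs in simp_all)
    then show "univ C P f' (act P h' \<alpha>) = act P h (univ C P f \<alpha>)"
      by (simp add: univP f f')
  qed
  then show ?thesis
    unfolding full_universal_iso_def using Q iso univP G by simp
qed

section \<open>Equivalences of preordered doctrines\<close>

text \<open>The laws of a preordered doctrine are assumed for \<open>Q\<close>; an \<open>F\<close>
  that preserves and reflects the order and is natural up to equivalence carries them back to
  \<open>P\<close>. This serves both the Turing preorders and the completion.\<close>

locale indexed_embedding = Q: pre_doctrine C Q
  for C :: "('o, 'm) cat" and Q :: "('o, 'm, 'q) indexed" +
  fixes P :: "('o, 'm, 'p) indexed" and F :: "'o \<Rightarrow> 'p \<Rightarrow> 'q"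
  assumes le_elts: "X \<in> obj C \<Longrightarrow> (\<alpha>, \<beta>) \<in> le P X \<Longrightarrow> \<alpha> \<in> elts P X \<and> \<beta> \<in> elts P X"
    and act_elts: "f \<in> hom C X Y \<Longrightarrow> \<alpha> \<in> elts P Y \<Longrightarrow> act P f \<alpha> \<in> elts P X"
    and F_elts: "X \<in> obj C \<Longrightarrow> \<alpha> \<in> elts P X \<Longrightarrow> F X \<alpha> \<in> elts Q X"
    and F_le_iff: "X \<in> obj C \<Longrightarrow> \<alpha> \<in> elts P X \<Longrightarrow> \<beta> \<in> elts P X \<Longrightarrow>
        (F X \<alpha>, F X \<beta>) \<in> le Q X \<longleftrightarrow> (\<alpha>, \<beta>) \<in> le P X"
    and F_act: "f \<in> hom C X Y \<Longrightarrow> \<alpha> \<in> elts P Y \<Longrightarrow>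
        (F X (act P f \<alpha>), act Q f (F Y \<alpha>)) \<in> equivalent Q X"
begin

lemma F_equivalent_iff:
  "X \<in> obj C \<Longrightarrow> \<alpha> \<in> elts P X \<Longrightarrow> \<beta> \<in> elts P X \<Longrightarrow>
    (F X \<alpha>, F X \<beta>) \<in> equivalent Q X \<longleftrightarrow> (\<alpha>, \<beta>) \<in> equivalent P X"
  by (simp add: equivalent_def F_le_iff)

lemma F_le_act:
  assumes f: "f \<in> hom C X Y" and \<alpha>: "\<alpha> \<in> elts P Y" and \<beta>: "\<beta> \<in> elts P Y"
    and le: "(\<alpha>, \<beta>) \<in> le P Y"
  shows "(act P f \<alpha>, act P f \<beta>) \<in> le P X"
proof -
  have X: "X \<in> obj C" and Y: "Y \<in> obj C" using Q.hom_obj[OF f] by auto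
  have "(act Q f (F Y \<alpha>), act Q f (F Y \<beta>)) \<in> le Q X"
    using Q.act_mono[OF f] F_le_iff[OF Y \<alpha> \<beta>] le by blast
  then have "(F X (act P f \<alpha>), F X (act P f \<beta>)) \<in> le Q X"
    using F_act[OF f \<alpha>] F_act[OF f \<beta>] Q.le_trans[OF X] unfolding Q.equivalent_iff by blast
  then show ?thesis using F_le_iff[OF X act_elts[OF f \<alpha>] act_elts[OF f \<beta>]] by simp
qed

lemma Q_equiv_sym: "(\<phi>, \<psi>) \<in> equivalent Q X \<Longrightarrow> (\<psi>, \<phi>) \<in> equivalent Q X"
  by (auto simp: equivalent_def)

lemma Q_equiv_trans: "X \<in> obj C \<Longrightarrow> (\<phi>, \<psi>) \<in> equivalent Q X \<Longrightarrow> (\<psi>, \<chi>) \<in> equivalent Q X \<Longrightarrow>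
    (\<phi>, \<chi>) \<in> equivalent Q X"
  unfolding Q.equivalent_iff using Q.le_trans by blast

lemma Q_act_equiv: "f \<in> hom C X Y \<Longrightarrow> (\<phi>, \<psi>) \<in> equivalent Q Y \<Longrightarrow>
    (act Q f \<phi>, act Q f \<psi>) \<in> equivalent Q X"
  unfolding Q.equivalent_iff using Q.act_mono by blast

text \<open>Each law is verified in \<open>Q\<close> after applying \<open>F\<close> and then
  reflected. For composites, both sides are equivalent in \<open>Q\<close> to the iterated
  reindexing of \<open>F Z \<alpha>\<close>.\<close>

lemma pre_doctrine: "pre_doctrine C P"
proof (intro pre_doctrine.intro pre_doctrine_axioms.intro)
  show "category C" by (rule Q.category_axioms)
  show "has_finite_products C" by (rule Q.finite_products)
  show "X \<in> obj C \<Longrightarrow> (\<alpha>, \<beta>) \<in> le P X \<Longrightarrow> \<alpha> \<in> elts P X \<and> \<beta> \<in> elts P X" for X \<alpha> \<beta>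
    by (rule le_elts)
  show "X \<in> obj C \<Longrightarrow> \<alpha> \<in> elts P X \<Longrightarrow> (\<alpha>, \<alpha>) \<in> le P X" for X \<alpha>
    using F_le_iff Q.le_refl F_elts by blast
  show "X \<in> obj C \<Longrightarrow> (\<alpha>, \<beta>) \<in> le P X \<Longrightarrow> (\<beta>, \<gamma>) \<in> le P X \<Longrightarrow> (\<alpha>, \<gamma>) \<in> le P X" for X \<alpha> \<beta> \<gamma>
    using F_le_iff Q.le_trans le_elts by metis
  show "f \<in> hom C X Y \<Longrightarrow> \<alpha> \<in> elts P Y \<Longrightarrow> act P f \<alpha> \<in> elts P X" for f X Y \<alpha>
    by (rule act_elts)
  show "(act P f \<alpha>, act P f \<beta>) \<in> le P X" if "f \<in> hom C X Y" "(\<alpha>, \<beta>) \<in> le P Y" for f X Y \<alpha> \<beta>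
    using F_le_act that le_elts Q.hom_obj by blast
next
  fix X \<alpha> assume X: "X \<in> obj C" and \<alpha>: "\<alpha> \<in> elts P X"
  note i = Q.idn_hom[OF X]
  have "(F X (act P (idn C X) \<alpha>), F X \<alpha>) \<in> equivalent Q X"
    using Q_equiv_trans[OF X F_act[OF i \<alpha>] Q.act_idn[OF X F_elts[OF X \<alpha>]]] .
  then show "(act P (idn C X) \<alpha>, \<alpha>) \<in> equivalent P X"
    using F_equivalent_iff[OF X act_elts[OF i \<alpha>] \<alpha>] by simp
next
  fix f X Y g Z \<alpha> assume f: "f \<in> hom C X Y" and g: "g \<in> hom C Y Z" and \<alpha>: "\<alpha> \<in> elts P Z"
  have X: "X \<in> obj C" and Z: "Z \<in> obj C" using Q.hom_obj f g by blast+
  note gf = Q.cmp_hom[OF f g]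
  have "(F X (act P (cmp C g f) \<alpha>), act Q f (act Q g (F Z \<alpha>))) \<in> equivalent Q X"
    using Q_equiv_trans[OF X F_act[OF gf \<alpha>] Q.act_cmp[OF f g F_elts[OF Z \<alpha>]]] .
  moreover have "(F X (act P f (act P g \<alpha>)), act Q f (act Q g (F Z \<alpha>))) \<in> equivalent Q X"
    using Q_equiv_trans[OF X F_act[OF f act_elts[OF g \<alpha>]] Q_act_equiv[OF f F_act[OF g \<alpha>]]] .
  ultimately have "(F X (act P (cmp C g f) \<alpha>), F X (act P f (act P g \<alpha>))) \<in> equivalent Q X"
    using Q_equiv_trans[OF X] Q_equiv_sym by blast
  then show "(act P (cmp C g f) \<alpha>, act P f (act P g \<alpha>)) \<in> equivalent P X"
    using F_equivalent_iff[OF X act_elts[OF gf \<alpha>] act_elts[OF f act_elts[OF g \<alpha>]]] by simp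
qed

end

locale indexed_equivalence = indexed_embedding +
  assumes F_surj: "X \<in> obj C \<Longrightarrow> \<phi> \<in> elts Q X \<Longrightarrow> \<exists>\<alpha>\<in>elts P X. (F X \<alpha>, \<phi>) \<in> equivalent Q X"
begin

text \<open>\<open>F\<close> preserves equivalence, so it is well defined on classes; it reflects
  equivalence, so it is injective there; \<open>F_surj\<close> gives surjectivity. Naturality up to
  equivalence becomes strict.\<close>

lemma reflection_iso:
  obtains \<theta> where "doctrine_iso C (poset_reflection C P) (poset_reflection C Q) \<theta>"
    and "\<forall>X\<in>obj C. \<forall>\<alpha>\<in>elts P X. \<theta> X (eclass P X \<alpha>) = eclass Q X (F X \<alpha>)"
proof -
  interpret P: pre_doctrine C P by (rule pre_doctrine)
  define \<theta> where "\<theta> X c = eclass Q X (F X (SOME \<alpha>. \<alpha> \<in> elts P X \<and> c = eclass P X \<alpha>))" for X c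
  have \<theta>: "\<theta> X (eclass P X \<alpha>) = eclass Q X (F X \<alpha>)" if X: "X \<in> obj C" and \<alpha>: "\<alpha> \<in> elts P X" for X \<alpha>
  proof -
    define \<beta> where "\<beta> = (SOME \<beta>. \<beta> \<in> elts P X \<and> eclass P X \<alpha> = eclass P X \<beta>)"
    have \<beta>: "\<beta> \<in> elts P X \<and> eclass P X \<alpha> = eclass P X \<beta>"
      unfolding \<beta>_def by (rule someI[of _ \<alpha>]) (simp add: \<alpha>)
    then have "(F X \<alpha>, F X \<beta>) \<in> equivalent Q X"
      using P.eclass_eq_iff[OF X \<alpha>] F_equivalent_iff[OF X \<alpha>] by blast
    then show ?thesis using Q.eclass_eq[OF X] by (simp add: \<theta>_def \<beta>_def)
  qed
  let ?P = "poset_reflection C P" and ?Q = "poset_reflection C Q"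
  have "doctrine_iso C ?P ?Q \<theta>"
    unfolding doctrine_iso_def
  proof (intro conjI ballI)
    show "doctrine C ?P" "doctrine C ?Q"
      by (rule P.doctrine_reflection Q.doctrine_reflection)+
  next
    fix X assume X: "X \<in> obj C"
    show "bij_betw (\<theta> X) (elts ?P X) (elts ?Q X)"
      unfolding bij_betw_def
    proof
      show "inj_on (\<theta> X) (elts ?P X)"
        by (auto intro!: inj_onI P.eclass_eq[OF X] simp: P.reflection_elts \<theta> X Q.eclass_eq_iff
            F_elts F_equivalent_iff)
      show "\<theta> X ` elts ?P X = elts ?Q X"
      proof
        show "\<theta> X ` elts ?P X \<subseteq> elts ?Q X"
          by (auto simp: P.reflection_elts Q.reflection_elts \<theta> X F_elts)
        show "elts ?Q X \<subseteq> \<theta> X ` elts ?P X"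
        proof
          fix d assume "d \<in> elts ?Q X"
          then obtain \<phi> where \<phi>: "\<phi> \<in> elts Q X" and d: "d = eclass Q X \<phi>"
            by (auto simp: Q.reflection_elts)
          obtain \<alpha> where \<alpha>: "\<alpha> \<in> elts P X" and "(F X \<alpha>, \<phi>) \<in> equivalent Q X"
            using F_surj[OF X \<phi>] by blast
          then have "\<theta> X (eclass P X \<alpha>) = d" using Q.eclass_eq[OF X] by (simp add: \<theta> X d)
          then show "d \<in> \<theta> X ` elts ?P X" using \<alpha> by (auto simp: P.reflection_elts)
        qed
      qed
    qed
    show "(c, d) \<in> le ?P X \<longleftrightarrow> (\<theta> X c, \<theta> X d) \<in> le ?Q X"
      if "c \<in> elts ?P X" "d \<in> elts ?P X" for c d
      using that by (auto simp: P.reflection_elts \<theta> X P.reflection_le_iff Q.reflection_le_iff F_elts F_le_iff)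
  next
    fix f c assume f: "f \<in> arr C" and "c \<in> elts ?P (target C f)"
    then obtain \<alpha> where \<alpha>: "\<alpha> \<in> elts P (target C f)" and c: "c = eclass P (target C f) \<alpha>"
      by (auto simp: P.reflection_elts)
    have h: "f \<in> hom C (source C f) (target C f)" using f by (simp add: hom_def)
    show "\<theta> (source C f) (act ?P f c) = act ?Q f (\<theta> (target C f) c)"
      using Q.eclass_eq[OF _ F_act[OF h \<alpha>]] Q.hom_obj[OF h] \<alpha>
      by (simp add: c P.reflection_act[OF h] \<theta> act_elts[OF h] Q.reflection_act[OF h] F_elts)
  qed
  with \<theta> show ?thesis using that by blast
qed

end

text \<open>The completion is formed over classes, while realizers act on functions. For each
  mediating \<open>h\<close> the two order conditions agree, so the completion order may be computed
  on representatives.\<close>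

lemma (in pre_doctrine) completion_reflection_le_iff:
  assumes X: "X \<in> obj C"
    and f: "f \<in> arr C" "target C f = X" "\<alpha> \<in> elts P (source C f)"
    and g: "g \<in> arr C" "target C g = X" "\<beta> \<in> elts P (source C g)"
  shows "((f, eclass P (source C f) \<alpha>), (g, eclass P (source C g) \<beta>))
            \<in> le (completion_pre C (poset_reflection C P)) X
     \<longleftrightarrow> ((f, \<alpha>), (g, \<beta>)) \<in> le (completion_pre C P) X"
proof -
  have "(act (poset_reflection C P) h (eclass P (source C f) \<alpha>), eclass P (source C g) \<beta>)
          \<in> le (poset_reflection C P) (source C g) \<longleftrightarrow> (act P h \<alpha>, \<beta>) \<in> le P (source C g)"
    if h: "h \<in> hom C (source C g) (source C f)" for h
    using reflection_le_iff[OF source_obj[OF g(1)] act_elts[OF h f(3)] g(3)]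
    by (simp add: reflection_act[OF h f(3)])
  then show ?thesis
    using f g by (auto simp: completion_pre_def reflection_elts)
qed

section \<open>The category of sets\<close>

lemma Sets_simps [simp]:
  "obj (Sets U) = U"
  "(X, f, Y) \<in> arr (Sets U) \<longleftrightarrow> X \<in> U \<and> Y \<in> U \<and> f \<in> X \<rightarrow>\<^sub>E Y"
  "source (Sets U) (X, f, Y) = X"
  "target (Sets U) (X, f, Y) = Y"
  "idn (Sets U) X = (X, \<lambda>x\<in>X. x, X)"
  "cmp (Sets U) (Y, g, Z) (X, f, Y') = (X, compose X g f, Z)"
  by (auto simp: Sets_def)

lemma hom_Sets_iff [simp]:
  "(X', f, Y') \<in> hom (Sets U) X Y \<longleftrightarrow> X' = X \<and> Y' = Y \<and> X \<in> U \<and> Y \<in> U \<and> f \<in> X \<rightarrow>\<^sub>E Y"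
  by (auto simp: hom_def)

lemma hom_SetsE:
  assumes "h \<in> hom (Sets U) X Y"
  obtains f where "h = (X, f, Y)" "X \<in> U" "Y \<in> U" "f \<in> X \<rightarrow>\<^sub>E Y"
  using assms by (cases h) auto

lemma compose_PiE: "f \<in> X \<rightarrow>\<^sub>E Y \<Longrightarrow> g \<in> Y \<rightarrow>\<^sub>E Z \<Longrightarrow> compose X g f \<in> X \<rightarrow>\<^sub>E Z"
  by (auto simp: compose_def)

lemma category_Sets: "category (Sets U)"
proof
  fix f assume "f \<in> arr (Sets U)"
  then show "source (Sets U) f \<in> obj (Sets U)" "target (Sets U) f \<in> obj (Sets U)"
    by (cases f; simp)+
next
  fix X assume "X \<in> obj (Sets U)"
  then show "idn (Sets U) X \<in> hom (Sets U) X X" by auto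
next
  fix f X Y g Z assume "f \<in> hom (Sets U) X Y" "g \<in> hom (Sets U) Y Z"
  then show "cmp (Sets U) g f \<in> hom (Sets U) X Z"
    by (elim hom_SetsE) (simp add: compose_PiE)
next
  fix f X Y assume "f \<in> hom (Sets U) X Y"
  then show "cmp (Sets U) f (idn (Sets U) X) = f" "cmp (Sets U) (idn (Sets U) Y) f = f"
    by (auto elim!: hom_SetsE simp: compose_def fun_eq_iff PiE_def extensional_def Pi_def)
next
  fix f X Y g Z h W
  assume "f \<in> hom (Sets U) X Y" "g \<in> hom (Sets U) Y Z" "h \<in> hom (Sets U) Z W"
  then show "cmp (Sets U) h (cmp (Sets U) g f) = cmp (Sets U) (cmp (Sets U) h g) f"
    by (auto elim!: hom_SetsE simp: compose_def fun_eq_iff PiE_def Pi_def)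
qed

section \<open>Pullbacks of small sets, their points and fibres, and finite products\<close>

context set_universe
begin

text \<open>Products exist in \<open>U\<close> only up to bijection, so a set of pairs has to be
  replaced by a copy. This supplies both the pullbacks and the domain of a preimage of a Medvedev
  function.\<close>

lemma subset_of_product:
  assumes X: "X \<in> U" and Y: "Y \<in> U" and S: "S \<subseteq> X \<times> Y"
  obtains D b where "D \<in> U" "bij_betw b D S"
proof -
  obtain Z where Z: "Z \<in> U" "Z \<approx> X \<times> Y" using product_closed[OF X Y] by blast
  then obtain b where b: "bij_betw b Z (X \<times> Y)" unfolding eqpoll_def by blast
  let ?D = "{z \<in> Z. b z \<in> S}"
  have "?D \<in> U" by (rule subset_closed[OF Z(1)]) blast
  moreover have "bij_betw b ?D S"
  proof (rule bij_betw_subset[OF b])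
    have "b ` ?D = b ` Z \<inter> S" by auto
    then show "b ` ?D = S" using S by (simp only: bij_betw_imp_surj_on[OF b] Int_absorb1)
  qed blast
  ultimately show ?thesis using that by blast
qed

text \<open>The usual set of compatible pairs, coded by a small set \<open>D\<close> through a
  bijection \<open>b\<close>; the projections are the components of \<open>b\<close>.\<close>

lemma exists_pullback:
  assumes X: "X \<in> U" and Y: "Y \<in> U" and Z: "Z \<in> U" and f: "f \<in> X \<rightarrow>\<^sub>E Z" and g: "g \<in> Y \<rightarrow>\<^sub>E Z"
  obtains D p q where "is_pullback (Sets U) (X, f, Z) (Y, g, Z) (D, p, X) (D, q, Y)"
proof -
  obtain D b where D: "D \<in> U" and b: "bij_betw b D {(x, y). x \<in> X \<and> y \<in> Y \<and> f x = g y}"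
    using subset_of_product[OF X Y, of "{(x, y). x \<in> X \<and> y \<in> Y \<and> f x = g y}"] by blast
  have bD: "fst (b d) \<in> X \<and> snd (b d) \<in> Y \<and> f (fst (b d)) = g (snd (b d))" if "d \<in> D" for d
    using bij_betwE[OF b] that by fastforce
  define p where "p = (\<lambda>d\<in>D. fst (b d))"
  define q where "q = (\<lambda>d\<in>D. snd (b d))"
  have p: "p \<in> D \<rightarrow>\<^sub>E X" and q: "q \<in> D \<rightarrow>\<^sub>E Y" using bD by (auto simp: p_def q_def)
  \<comment> \<open>Injectivity of \<open>b\<close> means that a code is determined by its two
    projections; this gives uniqueness of the mediating map.\<close>
  have uniq: "d = d'" if "d \<in> D" "d' \<in> D" "p d = p d'" "q d = q d'" for d d'
    using that bij_betw_imp_inj_on[OF b] by (auto simp: p_def q_def inj_on_def prod_eq_iff)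
  have "is_pullback (Sets U) (X, f, Z) (Y, g, Z) (D, p, X) (D, q, Y)"
    unfolding is_pullback_def Sets_simps
  proof (intro conjI X Y Z D f g p q refl ballI impI)
    show "(D, compose D f p, Z) = (D, compose D g q, Z)"
      using bD by (auto simp: compose_def fun_eq_iff p_def q_def)
  next
    fix W u v
    assume W: "W \<in> U" and "u \<in> hom (Sets U) W X" "v \<in> hom (Sets U) W Y"
      and comm: "cmp (Sets U) (X, f, Z) u = cmp (Sets U) (Y, g, Z) v"
    then obtain a c where u: "u = (W, a, X)" "a \<in> W \<rightarrow>\<^sub>E X" and v: "v = (W, c, Y)" "c \<in> W \<rightarrow>\<^sub>E Y"
      by (auto elim!: hom_SetsE)
    have fg: "f (a w) = g (c w)" if "w \<in> W" for w
      using comm that by (auto simp: u v compose_def fun_eq_iff dest: spec[of _ w])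
    \<comment> \<open>The mediating map sends \<open>w\<close> to the code of the pair
      \<open>(a w, c w)\<close>, which is compatible by \<open>fg\<close>.\<close>
    define k where "k = (\<lambda>w\<in>W. inv_into D b (a w, c w))"
    have k: "k w \<in> D \<and> p (k w) = a w \<and> q (k w) = c w" if "w \<in> W" for w
    proof -
      have "(a w, c w) \<in> b ` D"
        using bij_betw_imp_surj_on[OF b] that u v fg by auto
      from inv_into_into[OF this] f_inv_into_f[OF this] show ?thesis
        using that by (simp add: k_def p_def q_def)
    qed
    show "\<exists>!h. h \<in> hom (Sets U) W D \<and> cmp (Sets U) (D, p, X) h = u \<and> cmp (Sets U) (D, q, Y) h = v"
    proof (rule ex1I[of _ "(W, k, D)"])
      have "k \<in> W \<rightarrow>\<^sub>E D" using k by (auto simp: k_def)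
      moreover have "compose W p k = a" "compose W q k = c"
        using k u v by (auto simp: compose_def fun_eq_iff PiE_def extensional_def)
      ultimately show "(W, k, D) \<in> hom (Sets U) W D \<and> cmp (Sets U) (D, p, X) (W, k, D) = u
          \<and> cmp (Sets U) (D, q, Y) (W, k, D) = v"
        using W D u v by simp
    next
      fix h assume h: "h \<in> hom (Sets U) W D \<and> cmp (Sets U) (D, p, X) h = u \<and> cmp (Sets U) (D, q, Y) h = v"
      then obtain l where l: "h = (W, l, D)" "l \<in> W \<rightarrow>\<^sub>E D" by (auto elim!: hom_SetsE)
      with h u v have "compose W p l = a" "compose W q l = c" by simp_all
      then have "p (l w) = a w" "q (l w) = c w" if "w \<in> W" for w
        using that by (auto simp: compose_def fun_eq_iff dest!: spec[of _ w])
      then have "l w = k w" if "w \<in> W" for w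
        using uniq[of "l w" "k w"] that k[OF that] l by auto
      moreover have "k \<in> extensional W" by (simp add: k_def)
      ultimately have "l = k" using l by (auto simp: PiE_def intro: extensionalityI)
      then show "h = (W, k, D)" using l by simp
    qed
  qed
  then show ?thesis using that by blast
qed

lemma pullback_lift:
  assumes "is_pullback (Sets U) (X, f, Z) (Y, g, Z) (D, p, X) (D, q, Y)"
    and "W \<in> U" "u \<in> hom (Sets U) W X" "v \<in> hom (Sets U) W Y"
    and "cmp (Sets U) (X, f, Z) u = cmp (Sets U) (Y, g, Z) v"
  shows "\<exists>!h. h \<in> hom (Sets U) W D \<and> cmp (Sets U) (D, p, X) h = u \<and> cmp (Sets U) (D, q, Y) h = v"
proof -
  have "\<forall>W\<in>U. \<forall>u\<in>hom (Sets U) W X. \<forall>v\<in>hom (Sets U) W Y.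
      cmp (Sets U) (X, f, Z) u = cmp (Sets U) (Y, g, Z) v \<longrightarrow>
      (\<exists>!h. h \<in> hom (Sets U) W D \<and> cmp (Sets U) (D, p, X) h = u \<and> cmp (Sets U) (D, q, Y) h = v)"
    using assms(1) unfolding is_pullback_def Sets_simps by (elim conjE)
  from this[rule_format, OF assms(2-5)] show ?thesis .
qed

text \<open>The universal property is tested on a one-point set: a compatible pair is a cone with
  vertex \<open>{x}\<close>, which is small as a subset of \<open>X\<close>, and the value of the
  mediating map at \<open>x\<close> is the point sought.\<close>

lemma pullback_point:
  assumes pb: "is_pullback (Sets U) (X, f, Z) (Y, g, Z) (D, p, X) (D, q, Y)"
    and x: "x \<in> X" and y: "y \<in> Y" and eq: "f x = g y"
  obtains d where "d \<in> D" "p d = x" "q d = y"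
proof -
  have X: "X \<in> U" and Y: "Y \<in> U" using pb by (auto simp: is_pullback_def)
  have W: "{x} \<in> U" by (rule subset_closed[OF X]) (simp add: x)
  have u: "({x}, \<lambda>w\<in>{x}. x, X) \<in> hom (Sets U) {x} X" using W X x by auto
  have v: "({x}, \<lambda>w\<in>{x}. y, Y) \<in> hom (Sets U) {x} Y" using W Y y by auto
  have comm: "cmp (Sets U) (X, f, Z) ({x}, \<lambda>w\<in>{x}. x, X) = cmp (Sets U) (Y, g, Z) ({x}, \<lambda>w\<in>{x}. y, Y)"
    using eq by (auto simp: compose_def)
  obtain h where h: "h \<in> hom (Sets U) {x} D"
      "cmp (Sets U) (D, p, X) h = ({x}, \<lambda>w\<in>{x}. x, X)"
      "cmp (Sets U) (D, q, Y) h = ({x}, \<lambda>w\<in>{x}. y, Y)"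
    using pullback_lift[OF pb W u v comm] by (elim ex1E conjE)
  then obtain l where l: "h = ({x}, l, D)" "l \<in> {x} \<rightarrow>\<^sub>E D" by (auto elim!: hom_SetsE)
  then have "l x \<in> D" and eqs: "compose {x} p l = (\<lambda>w\<in>{x}. x)" "compose {x} q l = (\<lambda>w\<in>{x}. y)"
    using h by auto
  moreover have "p (l x) = x" "q (l x) = y"
    using fun_cong[OF eqs(1), of x] fun_cong[OF eqs(2), of x] by (simp_all add: compose_eq)
  ultimately show ?thesis using that by blast
qed

text \<open>Commutativity gives one inclusion and \<open>pullback_point\<close> the other. An
  arbitrary pullback square is treated because the completion selects one by \<open>SOME\<close> and
  Beck-Chevalley ranges over all of them.\<close>

lemma pullback_fibres:
  assumes pb: "is_pullback (Sets U) (X, f, Z) (Y, g, Z) (D, p, X) (D, q, Y)"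
  shows "y \<in> Y \<Longrightarrow> p ` {d \<in> D. q d = y} = {x \<in> X. f x = g y}"
    and "x \<in> X \<Longrightarrow> q ` {d \<in> D. p d = x} = {y \<in> Y. g y = f x}"
proof -
  have p: "p \<in> D \<rightarrow>\<^sub>E X" and q: "q \<in> D \<rightarrow>\<^sub>E Y" and eq: "compose D f p = compose D g q"
    using pb by (auto simp: is_pullback_def)
  have comm: "f (p d) = g (q d)" if "d \<in> D" for d
    using fun_cong[OF eq, of d] that by (simp add: compose_eq)
  show "p ` {d \<in> D. q d = y} = {x \<in> X. f x = g y}" if y: "y \<in> Y"
  proof (intro equalityI subsetI)
    fix x assume "x \<in> {x \<in> X. f x = g y}"
    then obtain d where "d \<in> D" "p d = x" "q d = y" using pullback_point[OF pb _ y] by blast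
    then show "x \<in> p ` {d \<in> D. q d = y}" by blast
  qed (use p comm in auto)
  show "q ` {d \<in> D. p d = x} = {y \<in> Y. g y = f x}" if x: "x \<in> X"
  proof (intro equalityI subsetI)
    fix y assume "y \<in> {y \<in> Y. g y = f x}"
    then obtain d where "d \<in> D" "p d = x" "q d = y" using pullback_point[OF pb x, of y] by auto
    then show "y \<in> q ` {d \<in> D. p d = x}" by blast
  qed (use q comm in auto)
qed

text \<open>The product of two objects is their pullback over a one-point set.\<close>

lemma has_finite_products_Sets: "has_finite_products (Sets U)"
proof -
  obtain X0 x0 where X0: "X0 \<in> U" "x0 \<in> X0" using nontrivial by blast
  let ?T = "{x0}"
  have T: "?T \<in> U" by (rule subset_closed[OF X0(1)]) (simp add: X0(2))
  have const: "t = (X, \<lambda>x\<in>X. x0, ?T)" if "t \<in> hom (Sets U) X ?T" for t X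
    using that by (auto elim!: hom_SetsE simp: fun_eq_iff PiE_def extensional_def Pi_def)
  have const_in: "(X, \<lambda>x\<in>X. x0, ?T) \<in> hom (Sets U) X ?T" if "X \<in> U" for X
    using that T by auto
  have "\<exists>Z\<in>U. \<exists>p\<in>hom (Sets U) Z X. \<exists>q\<in>hom (Sets U) Z Y.
      \<forall>W\<in>U. \<forall>f\<in>hom (Sets U) W X. \<forall>g\<in>hom (Sets U) W Y.
        \<exists>!h. h \<in> hom (Sets U) W Z \<and> cmp (Sets U) p h = f \<and> cmp (Sets U) q h = g"
    if X: "X \<in> U" and Y: "Y \<in> U" for X Y
  proof -
    let ?f = "\<lambda>x\<in>X. x0" and ?g = "\<lambda>y\<in>Y. x0"
    obtain D p q where pb: "is_pullback (Sets U) (X, ?f, ?T) (Y, ?g, ?T) (D, p, X) (D, q, Y)"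
      using exists_pullback[OF X Y T, of ?f ?g] by auto
    have comm: "cmp (Sets U) (X, ?f, ?T) u = cmp (Sets U) (Y, ?g, ?T) v"
      if "u \<in> hom (Sets U) W X" "v \<in> hom (Sets U) W Y" for W u v
      using that by (auto elim!: hom_SetsE simp: compose_def fun_eq_iff PiE_def Pi_def)
    have "\<forall>W\<in>U. \<forall>u\<in>hom (Sets U) W X. \<forall>v\<in>hom (Sets U) W Y.
        \<exists>!h. h \<in> hom (Sets U) W D \<and> cmp (Sets U) (D, p, X) h = u \<and> cmp (Sets U) (D, q, Y) h = v"
      by (intro ballI, rule pullback_lift[OF pb]) (auto intro: comm)
    moreover have "D \<in> U" "(D, p, X) \<in> hom (Sets U) D X" "(D, q, Y) \<in> hom (Sets U) D Y"
      using pb by (auto simp: is_pullback_def)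
    ultimately show ?thesis by blast
  qed
  then show ?thesis
    unfolding has_finite_products_def Sets_simps
  proof (intro conjI ballI)
    show "\<exists>T\<in>U. \<forall>X\<in>U. \<exists>!t. t \<in> hom (Sets U) X T"
    proof (intro bexI[of _ ?T] ballI T)
      fix X assume "X \<in> U"
      then show "\<exists>!t. t \<in> hom (Sets U) X ?T"
        using const_in const by (intro ex1I[of _ "(X, \<lambda>x\<in>X. x0, ?T)"]) auto
    qed
  qed
qed

end

section \<open>Realizers\<close>

context elementary_sub_pca
begin

text \<open>The combinator laws, stated with option terms and directed equality, are recast as
  existence of values, so that realizers can be computed one application at a time.\<close>

lemma sub_k_s:
  obtains k s where "k \<in> A'" "s \<in> A'"
    and "\<forall>a\<in>A. \<exists>ka\<in>A. app k a = Some ka \<and> (\<forall>b\<in>A. app ka b = Some a)"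
    and "\<forall>a\<in>A. \<forall>b\<in>A. \<exists>sa sab. app s a = Some sa \<and> app sa b = Some sab \<and>
        (\<forall>c\<in>A. \<forall>x y z. app a c = Some x \<longrightarrow> app b c = Some y \<longrightarrow> app x y = Some z \<longrightarrow>
            app sab c = Some z)"
proof -
  obtain k s where k: "k \<in> A'" "is_k A app k" and s: "s \<in> A'" "is_s A app s"
    using sub_combinators by blast
  have kA: "k \<in> A" using k sub_carrier by blast
  have 1: "\<exists>ka\<in>A. app k a = Some ka \<and> (\<forall>b\<in>A. app ka b = Some a)" if a: "a \<in> A" for a
  proof -
    obtain ka where ka: "app k a = Some ka" using k(2) a unfolding is_k_def by blast
    then have "\<forall>b\<in>A. app ka b = Some a"
      using k(2) a by (auto simp: is_k_def directed_eq_def app_term_def)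
    then show ?thesis using ka app_closed[OF kA a ka] by blast
  qed
  have 2: "\<exists>sa sab. app s a = Some sa \<and> app sa b = Some sab \<and>
        (\<forall>c\<in>A. \<forall>x y z. app a c = Some x \<longrightarrow> app b c = Some y \<longrightarrow> app x y = Some z \<longrightarrow>
            app sab c = Some z)" if a: "a \<in> A" and b: "b \<in> A" for a b
  proof -
    obtain sa where sa: "app s a = Some sa" using s(2) a unfolding is_s_def by blast
    moreover obtain sab where sab: "app sa b = Some sab"
      using s(2) a b sa by (fastforce simp: is_s_def app_term_def)
    moreover have "app sab c = Some z"
      if "c \<in> A" "app a c = Some x" "app b c = Some y" "app x y = Some z" for c x y z
    proof -
      have "directed_eq (app_term app (app_term app (app s a) (Some b)) (Some c))
          (app_term app (app a c) (app b c))"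
        using s(2) a b that(1) unfolding is_s_def by blast
      then show ?thesis using that sa sab by (simp add: directed_eq_def app_term_def)
    qed
    ultimately show ?thesis by blast
  qed
  show ?thesis by (rule that[OF k(1) s(1)]) (use 1 2 in blast)+
qed

text \<open>The realizer is \<open>s k k\<close>: applied to \<open>a\<close> it gives
  \<open>k a (k a)\<close>, which is \<open>a\<close>.\<close>

lemma identity_realizer: obtains i where "i \<in> A'" "\<And>a. a \<in> A \<Longrightarrow> app i a = Some a"
proof -
  obtain k s where k: "k \<in> A'" and s: "s \<in> A'"
    and ka: "\<forall>a\<in>A. \<exists>ka\<in>A. app k a = Some ka \<and> (\<forall>b\<in>A. app ka b = Some a)"
    and sab: "\<forall>a\<in>A. \<forall>b\<in>A. \<exists>sa sab. app s a = Some sa \<and> app sa b = Some sab \<and>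
        (\<forall>c\<in>A. \<forall>x y z. app a c = Some x \<longrightarrow> app b c = Some y \<longrightarrow> app x y = Some z \<longrightarrow>
            app sab c = Some z)"
    by (rule sub_k_s)
  have kA: "k \<in> A" using k sub_carrier by blast
  obtain sk skk where skk: "app s k = Some sk" "app sk k = Some skk"
    and *: "\<forall>c\<in>A. \<forall>x y z. app k c = Some x \<longrightarrow> app k c = Some y \<longrightarrow> app x y = Some z \<longrightarrow> app skk c = Some z"
    using bspec[OF bspec[OF sab kA] kA] by blast
  have "skk \<in> A'" using sub_app_closed skk k s by blast
  moreover have "app skk a = Some a" if "a \<in> A" for a using * bspec[OF ka that] that by blast
  ultimately show ?thesis using that by blast
qed

text \<open>The realizer is \<open>s (k a) b\<close>: applied to \<open>x\<close> it gives
  \<open>k a x (b x)\<close>, that is, \<open>a (b x)\<close>. It is built from members of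
  \<open>A'\<close> by application, hence stays in \<open>A'\<close>.\<close>

lemma composite_realizer:
  assumes a: "a \<in> A'" and b: "b \<in> A'"
  obtains c where "c \<in> A'"
    and "\<And>x y z. x \<in> A \<Longrightarrow> app b x = Some y \<Longrightarrow> app a y = Some z \<Longrightarrow> app c x = Some z"
proof -
  obtain k s where k: "k \<in> A'" and s: "s \<in> A'"
    and ka: "\<forall>a\<in>A. \<exists>ka\<in>A. app k a = Some ka \<and> (\<forall>b\<in>A. app ka b = Some a)"
    and sab: "\<forall>a\<in>A. \<forall>b\<in>A. \<exists>sa sab. app s a = Some sa \<and> app sa b = Some sab \<and>
        (\<forall>c\<in>A. \<forall>x y z. app a c = Some x \<longrightarrow> app b c = Some y \<longrightarrow> app x y = Some z \<longrightarrow>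
            app sab c = Some z)"
    by (rule sub_k_s)
  have aA: "a \<in> A" and bA: "b \<in> A" using a b sub_carrier by blast+
  obtain ka where ka: "ka \<in> A" "app k a = Some ka" "\<forall>b\<in>A. app ka b = Some a"
    using bspec[OF ka aA] by blast
  obtain r t where rt: "app s ka = Some r" "app r b = Some t"
    and *: "\<forall>c\<in>A. \<forall>x y z. app ka c = Some x \<longrightarrow> app b c = Some y \<longrightarrow> app x y = Some z \<longrightarrow> app t c = Some z"
    using bspec[OF bspec[OF sab ka(1)] bA] by blast
  have "ka \<in> A'" using sub_app_closed[OF k a ka(2)] .
  then have "t \<in> A'" using sub_app_closed s rt b by blast
  then show ?thesis using that * ka(3) by blast
qed

end

section \<open>The Turing and Medvedev doctrines\<close>

text \<open>Smallness of the carrier ensures that the pairs \<open>(x, a)\<close> with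
  \<open>a\<close> in \<open>\<phi> x\<close>, a subset of \<open>X \<times> A\<close>, have a copy
  in \<open>U\<close>.\<close>

locale small_pca = set_universe U + elementary_sub_pca A app A'
  for U :: "'u set set" and A :: "'u set" and app :: "'u \<Rightarrow> 'u \<Rightarrow> 'u option" and A' :: "'u set" +
  assumes carrier_small: "A \<in> U"
begin

abbreviation "M \<equiv> medvedev_pre A app A'"
abbreviation "T \<equiv> turing_pre A app A'"

lemma M_simps [simp]:
  "elts M X = (X \<rightarrow>\<^sub>E Pow A)"
  "act M (X, f, Y) \<phi> = compose X \<phi> f"
  by (simp_all add: medvedev_pre_def)

lemma M_le_iff:
  "(\<phi>, \<psi>) \<in> le M X \<longleftrightarrow> \<phi> \<in> X \<rightarrow>\<^sub>E Pow A \<and> \<psi> \<in> X \<rightarrow>\<^sub>E Pow A \<and>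
     (\<exists>a\<in>A'. \<forall>x\<in>X. \<forall>b\<in>\<psi> x. \<exists>c\<in>\<phi> x. app a b = Some c)"
  by (simp add: medvedev_pre_def)

lemma T_simps [simp]:
  "elts T X = (X \<rightarrow>\<^sub>E A)"
  "act T (X, f, Y) \<alpha> = compose X \<alpha> f"
  by (simp_all add: turing_pre_def)

lemma T_le_iff:
  "(\<alpha>, \<beta>) \<in> le T X \<longleftrightarrow> \<alpha> \<in> X \<rightarrow>\<^sub>E A \<and> \<beta> \<in> X \<rightarrow>\<^sub>E A \<and> (\<exists>a\<in>A'. \<forall>x\<in>X. app a (\<beta> x) = Some (\<alpha> x))"
  by (simp add: turing_pre_def)

lemma M_le_refl: "\<phi> \<in> X \<rightarrow>\<^sub>E Pow A \<Longrightarrow> (\<phi>, \<phi>) \<in> le M X"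
  using identity_realizer unfolding M_le_iff by (metis PiE_mem PowD subsetD)

lemma M_le_trans:
  assumes 1: "(\<phi>, \<psi>) \<in> le M X" and 2: "(\<psi>, \<chi>) \<in> le M X"
  shows "(\<phi>, \<chi>) \<in> le M X"
proof -
  obtain a where a: "a \<in> A'" "\<forall>x\<in>X. \<forall>b\<in>\<psi> x. \<exists>c\<in>\<phi> x. app a b = Some c"
    using 1 by (auto simp: M_le_iff)
  obtain b where b: "b \<in> A'" "\<forall>x\<in>X. \<forall>d\<in>\<chi> x. \<exists>c\<in>\<psi> x. app b d = Some c"
    using 2 by (auto simp: M_le_iff)
  \<comment> \<open>Realizers run from the larger function to the smaller: \<open>b\<close> takes
    \<open>\<chi> x\<close> into \<open>\<psi> x\<close> and \<open>a\<close> takes that into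
    \<open>\<phi> x\<close>, so \<open>a\<close> is applied after \<open>b\<close>.\<close>
  obtain c where c: "c \<in> A'"
    and comp: "\<And>x y z. x \<in> A \<Longrightarrow> app b x = Some y \<Longrightarrow> app a y = Some z \<Longrightarrow> app c x = Some z"
    using composite_realizer[OF a(1) b(1)] by metis
  have "\<exists>e\<in>\<phi> x. app c d = Some e" if x: "x \<in> X" and d: "d \<in> \<chi> x" for x d
  proof -
    have dA: "d \<in> A" using 2 x d by (auto simp: M_le_iff)
    obtain y where y: "y \<in> \<psi> x" "app b d = Some y" using b(2) x d by blast
    obtain z where "z \<in> \<phi> x" "app a y = Some z" using a(2) x y by blast
    with comp[OF dA y(2)] show ?thesis by blast
  qed
  then show ?thesis using 1 2 c by (auto simp: M_le_iff)
qed

lemma M_pre_doctrine: "pre_doctrine (Sets U) M"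
proof (intro pre_doctrine.intro pre_doctrine_axioms.intro)
  show "category (Sets U)" by (rule category_Sets)
  show "has_finite_products (Sets U)" by (rule has_finite_products_Sets)
next
  fix X \<alpha> \<beta> assume "(\<alpha>, \<beta>) \<in> le M X"
  then show "\<alpha> \<in> elts M X \<and> \<beta> \<in> elts M X" by (simp add: M_le_iff)
next
  fix X \<alpha> assume "\<alpha> \<in> elts M X"
  then show "(\<alpha>, \<alpha>) \<in> le M X" by (simp add: M_le_refl)
next
  fix X \<alpha> \<beta> \<gamma> assume "(\<alpha>, \<beta>) \<in> le M X" "(\<beta>, \<gamma>) \<in> le M X"
  then show "(\<alpha>, \<gamma>) \<in> le M X" by (rule M_le_trans)
next
  fix f X Y \<alpha> assume "f \<in> hom (Sets U) X Y" "\<alpha> \<in> elts M Y"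
  then show "act M f \<alpha> \<in> elts M X"
    by (elim hom_SetsE) (simp add: compose_PiE)
next
  fix f X Y \<alpha> \<beta> assume "f \<in> hom (Sets U) X Y" and le: "(\<alpha>, \<beta>) \<in> le M Y"
  then obtain g where f: "f = (X, g, Y)" and g: "g \<in> X \<rightarrow>\<^sub>E Y" by (elim hom_SetsE)
  have \<alpha>: "\<alpha> \<in> Y \<rightarrow>\<^sub>E Pow A" and \<beta>: "\<beta> \<in> Y \<rightarrow>\<^sub>E Pow A" using le unfolding M_le_iff by blast+
  obtain a where "a \<in> A'" "\<forall>y\<in>Y. \<forall>b\<in>\<beta> y. \<exists>c\<in>\<alpha> y. app a b = Some c"
    using le unfolding M_le_iff by blast
  moreover from this have "\<forall>x\<in>X. \<forall>b\<in>\<beta> (g x). \<exists>c\<in>\<alpha> (g x). app a b = Some c"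
    using g by blast
  ultimately show "(act M f \<alpha>, act M f \<beta>) \<in> le M X"
    unfolding f M_simps M_le_iff
    by (intro conjI bexI[of _ a] compose_PiE[OF g] \<alpha> \<beta>) (simp_all add: compose_eq)
next
  fix X \<alpha> assume \<alpha>: "\<alpha> \<in> elts M X"
  then have "act M (idn (Sets U) X) \<alpha> = \<alpha>"
    by (auto simp: compose_def fun_eq_iff PiE_def extensional_def)
  then show "(act M (idn (Sets U) X) \<alpha>, \<alpha>) \<in> equivalent M X"
    using \<alpha> M_le_refl by (simp add: equivalent_def)
next
  fix f X Y g Z \<alpha>
  assume "f \<in> hom (Sets U) X Y" "g \<in> hom (Sets U) Y Z" and \<alpha>: "\<alpha> \<in> elts M Z"
  then obtain f' g' where f: "f = (X, f', Y)" "f' \<in> X \<rightarrow>\<^sub>E Y" and g: "g = (Y, g', Z)" "g' \<in> Y \<rightarrow>\<^sub>E Z"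
    by (elim hom_SetsE)
  have "act M (cmp (Sets U) g f) \<alpha> = act M f (act M g \<alpha>)"
    using f g by (auto simp: compose_def fun_eq_iff)
  moreover have "act M f (act M g \<alpha>) \<in> X \<rightarrow>\<^sub>E Pow A"
    using f g \<alpha> by (simp add: compose_PiE)
  ultimately show "(act M (cmp (Sets U) g f) \<alpha>, act M f (act M g \<alpha>)) \<in> equivalent M X"
    using M_le_refl by (simp add: equivalent_def)
qed

sublocale M: pre_doctrine "Sets U" M by (rule M_pre_doctrine)

text \<open>The Turing preorders inherit the axioms of a preordered doctrine from the Medvedev ones
  along the embedding by singletons.\<close>

sublocale T: indexed_embedding "Sets U" M T "\<lambda>X \<alpha>. \<lambda>x\<in>X. {\<alpha> x}"
proof
  fix f X Y \<alpha> assume "f \<in> hom (Sets U) X Y" and \<alpha>: "\<alpha> \<in> elts T Y"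
  then obtain g where f: "f = (X, g, Y)" and g: "g \<in> X \<rightarrow>\<^sub>E Y" by (elim hom_SetsE)
  show "act T f \<alpha> \<in> elts T X" using f g \<alpha> by (simp add: compose_PiE)
  have "(\<lambda>x\<in>X. {act T f \<alpha> x}) = act M f (\<lambda>y\<in>Y. {\<alpha> y})"
    using g by (auto simp: f compose_def fun_eq_iff)
  moreover have "(\<lambda>x\<in>X. {act T f \<alpha> x}) \<in> X \<rightarrow>\<^sub>E Pow A"
    using g \<alpha> by (auto simp: f compose_def)
  ultimately show "(\<lambda>x\<in>X. {act T f \<alpha> x}, act M f (\<lambda>y\<in>Y. {\<alpha> y})) \<in> equivalent M X"
    using M_le_refl by (simp add: equivalent_def)
qed (auto simp: T_le_iff M_le_iff)

sublocale T: pre_doctrine "Sets U" T by (rule T.pre_doctrine)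

section \<open>Fibre values\<close>

lemma fibre_values_in:
  "f \<in> Y \<rightarrow>\<^sub>E X \<Longrightarrow> \<alpha> \<in> Y \<rightarrow>\<^sub>E A \<Longrightarrow> fibre_values ((Y, f, X), \<alpha>) \<in> X \<rightarrow>\<^sub>E Pow A"
  by auto

text \<open>The core of the comparison: the same realizer works on both sides, and what is traded is
  the map \<open>h\<close> against a choice of points in fibres.\<close>

lemma fibre_values_le_iff:
  assumes X: "X \<in> U" and Y: "Y \<in> U" and Z: "Z \<in> U"
    and f: "f \<in> Y \<rightarrow>\<^sub>E X" and \<alpha>: "\<alpha> \<in> Y \<rightarrow>\<^sub>E A" and g: "g \<in> Z \<rightarrow>\<^sub>E X" and \<beta>: "\<beta> \<in> Z \<rightarrow>\<^sub>E A"
  shows "(fibre_values ((Y, f, X), \<alpha>), fibre_values ((Z, g, X), \<beta>)) \<in> le M X \<longleftrightarrow>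
     (((Y, f, X), \<alpha>), ((Z, g, X), \<beta>)) \<in> le (completion_pre (Sets U) T) X" (is "?m \<longleftrightarrow> ?c")
proof
  assume ?c
  then obtain u where "u \<in> hom (Sets U) Z Y" and u: "cmp (Sets U) (Y, f, X) u = (Z, g, X)"
      "(act T u \<alpha>, \<beta>) \<in> le T Z"
    by (auto simp: completion_pre_def)
  then obtain h where h: "u = (Z, h, Y)" "h \<in> Z \<rightarrow>\<^sub>E Y" by (elim hom_SetsE)
  have fh: "f (h z) = g z" if "z \<in> Z" for z
    using u(1) that by (auto simp: h compose_def fun_eq_iff dest: spec[of _ z])
  obtain a where a: "a \<in> A'" "\<forall>z\<in>Z. app a (\<beta> z) = Some (\<alpha> (h z))"
    using u(2) by (auto simp: h T_le_iff compose_eq)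
  have "\<exists>c\<in>fibre_values ((Y, f, X), \<alpha>) x. app a b = Some c"
    if x: "x \<in> X" and b: "b \<in> fibre_values ((Z, g, X), \<beta>) x" for x b
  proof -
    obtain z where "z \<in> Z" "g z = x" "b = \<beta> z" using x b by auto
    then show ?thesis using x a fh h by auto
  qed
  then show ?m
    using a(1) fibre_values_in[OF f \<alpha>] fibre_values_in[OF g \<beta>] unfolding M_le_iff by blast
next
  assume ?m
  then obtain a where a: "a \<in> A'" and
    *: "\<forall>x\<in>X. \<forall>b\<in>fibre_values ((Z, g, X), \<beta>) x. \<exists>c\<in>fibre_values ((Y, f, X), \<alpha>) x. app a b = Some c"
    unfolding M_le_iff by blast
  \<comment> \<open>As \<open>\<beta> z\<close> is a value over \<open>g z\<close>, the realizer
    sends it to a value over \<open>g z\<close> of the other family, which is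
    \<open>\<alpha> y\<close> for some \<open>y\<close> in that fibre.\<close>
  have "\<exists>y\<in>Y. f y = g z \<and> app a (\<beta> z) = Some (\<alpha> y)" if z: "z \<in> Z" for z
  proof -
    have "g z \<in> X" using g z by blast
    moreover have "\<beta> z \<in> fibre_values ((Z, g, X), \<beta>) (g z)" using z \<open>g z \<in> X\<close> by auto
    ultimately obtain c where "c \<in> fibre_values ((Y, f, X), \<alpha>) (g z)" "app a (\<beta> z) = Some c"
      using * by blast
    then show ?thesis using \<open>g z \<in> X\<close> by auto
  qed
  \<comment> \<open>The axiom of choice collects the points \<open>y\<close> into a function.
    Morphisms of the base are arbitrary maps, so no realizer for \<open>h0\<close> is called
    for.\<close>
  then obtain h0 where h0: "\<And>z. z \<in> Z \<Longrightarrow> h0 z \<in> Y \<and> f (h0 z) = g z \<and> app a (\<beta> z) = Some (\<alpha> (h0 z))"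
    by metis
  define h where "h = restrict h0 Z"
  have h: "h \<in> Z \<rightarrow>\<^sub>E Y" using h0 by (auto simp: h_def)
  have "compose Z f h = g"
    using h0 g by (auto simp: h_def compose_def fun_eq_iff PiE_def extensional_def)
  moreover have "(compose Z \<alpha> h, \<beta>) \<in> le T Z"
    using a h0 \<beta> compose_PiE[OF h \<alpha>] by (auto simp: T_le_iff compose_eq h_def)
  ultimately have "\<exists>u\<in>hom (Sets U) Z Y. cmp (Sets U) (Y, f, X) u = (Z, g, X) \<and> (act T u \<alpha>, \<beta>) \<in> le T Z"
    using Y Z h by (intro bexI[of _ "(Z, h, Y)"]) simp_all
  then show ?c
    using X Y Z f g \<alpha> \<beta> by (simp add: completion_pre_def)
qed

text \<open>With the map \<open>f\<close> fixed, a Turing realizer acts pointwise on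
  \<open>Y\<close> and therefore works unchanged on every fibre.\<close>

lemma fibre_values_mono:
  assumes f: "f \<in> Y \<rightarrow>\<^sub>E X" and le: "(\<alpha>, \<beta>) \<in> le T Y"
  shows "(fibre_values ((Y, f, X), \<alpha>), fibre_values ((Y, f, X), \<beta>)) \<in> le M X"
proof -
  obtain a where "a \<in> A'" "\<forall>y\<in>Y. app a (\<beta> y) = Some (\<alpha> y)" and "\<alpha> \<in> Y \<rightarrow>\<^sub>E A" "\<beta> \<in> Y \<rightarrow>\<^sub>E A"
    using le by (auto simp: T_le_iff)
  then show ?thesis
    unfolding M_le_iff using f by (intro conjI bexI[of _ a] fibre_values_in) auto
qed

lemma fibre_values_equivalent:
  "f \<in> Y \<rightarrow>\<^sub>E X \<Longrightarrow> (\<alpha>, \<beta>) \<in> equivalent T Y \<Longrightarrow>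
     (fibre_values ((Y, f, X), \<alpha>), fibre_values ((Y, f, X), \<beta>)) \<in> equivalent M X"
  by (simp only: T.equivalent_iff M.equivalent_iff fibre_values_mono)

text \<open>\<open>Y\<close> is a small copy of \<open>Sigma X \<phi>\<close>, and the components of
  its points serve as \<open>f\<close> and \<alpha>. The function \<phi> is recovered exactly, not
  merely up to equivalence.\<close>

lemma fibre_values_surj:
  assumes X: "X \<in> U" and \<phi>: "\<phi> \<in> X \<rightarrow>\<^sub>E Pow A"
  obtains Y f \<alpha> where "Y \<in> U" "f \<in> Y \<rightarrow>\<^sub>E X" "\<alpha> \<in> Y \<rightarrow>\<^sub>E A" "fibre_values ((Y, f, X), \<alpha>) = \<phi>"
proof -
  have "Sigma X \<phi> \<subseteq> X \<times> A" using \<phi> by auto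
  then obtain Y b where Y: "Y \<in> U" and b: "bij_betw b Y (Sigma X \<phi>)"
    using subset_of_product[OF X carrier_small] by blast
  have bY: "fst (b y) \<in> X \<and> snd (b y) \<in> \<phi> (fst (b y))" if "y \<in> Y" for y
    using bij_betwE[OF b] that by fastforce
  define f where "f = (\<lambda>y\<in>Y. fst (b y))"
  define \<alpha> where "\<alpha> = (\<lambda>y\<in>Y. snd (b y))"
  have "f \<in> Y \<rightarrow>\<^sub>E X" using bY by (auto simp: f_def)
  moreover have "\<alpha> \<in> Y \<rightarrow>\<^sub>E A"
  proof -
    have "snd (b y) \<in> A" if "y \<in> Y" for y
      using bY[OF that] PiE_mem[OF \<phi>, of "fst (b y)"] by blast
    then show ?thesis by (simp add: \<alpha>_def)
  qed
  moreover have "fibre_values ((Y, f, X), \<alpha>) x = \<phi> x" for x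
  proof (cases "x \<in> X")
    case True
    have "\<exists>y\<in>Y. c = \<alpha> y \<and> f y = x" if "c \<in> \<phi> x" for c
    proof -
      have "(x, c) \<in> b ` Y" using that True b by (simp add: bij_betw_def)
      then obtain y where "y \<in> Y" "b y = (x, c)" by auto
      then show ?thesis by (auto simp: f_def \<alpha>_def intro!: bexI[of _ y])
    qed
    then show ?thesis using True bY by (auto simp: f_def \<alpha>_def)
  next
    case False
    then show ?thesis using \<phi> by (auto simp: PiE_def extensional_def)
  qed
  ultimately show ?thesis using that Y by blast
qed

text \<open>The projection \<open>q\<close> carries the fibre of \<open>p\<close> over
  \<open>x\<close> onto the fibre of \<open>g\<close> over \<open>u x\<close>, so \<alpha> takes the
  same values on both; naturality is an equality at this level.\<close>

lemma fibre_values_pullback: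
  assumes pb: "is_pullback (Sets U) (X', u, X) (Y, g, X) (D, p, X') (D, q, Y)"
  shows "fibre_values ((D, p, X'), compose D \<alpha> q) = compose X' (fibre_values ((Y, g, X), \<alpha>)) u"
proof
  fix x
  have u: "u \<in> X' \<rightarrow>\<^sub>E X" using pb by (auto simp: is_pullback_def)
  show "fibre_values ((D, p, X'), compose D \<alpha> q) x = compose X' (fibre_values ((Y, g, X), \<alpha>)) u x"
  proof (cases "x \<in> X'")
    case True
    then have ux: "u x \<in> X" using u by blast
    have "fibre_values ((D, p, X'), compose D \<alpha> q) x = compose D \<alpha> q ` {d \<in> D. p d = x}"
      using True by auto
    also have "\<dots> = \<alpha> ` q ` {d \<in> D. p d = x}"
      unfolding image_image by (rule image_cong) (simp_all add: compose_eq)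
    also have "\<dots> = \<alpha> ` {y \<in> Y. g y = u x}"
      by (simp only: pullback_fibres(2)[OF pb True])
    also have "\<dots> = compose X' (fibre_values ((Y, g, X), \<alpha>)) u x"
      using True ux by (auto simp: compose_eq)
    finally show ?thesis .
  qed (simp add: compose_def)
qed

section \<open>Universal quantification in the Medvedev doctrine\<close>

text \<open>Union along fibres is a left adjoint for inclusion. Here it is a right adjoint, because
  realizers of \<phi> \<le> \<psi> send elements of \<psi> to elements of \<phi>, so larger sets are
  lower in the order.\<close>

definition forall_M :: "'u setmap \<Rightarrow> ('u \<Rightarrow> 'u set) \<Rightarrow> 'u \<Rightarrow> 'u set" where
  "forall_M = (\<lambda>(X, f, Y) \<phi>. \<lambda>y\<in>Y. \<Union>x\<in>{x \<in> X. f x = y}. \<phi> x)"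

lemma forall_M_in: "f \<in> X \<rightarrow>\<^sub>E Y \<Longrightarrow> \<phi> \<in> X \<rightarrow>\<^sub>E Pow A \<Longrightarrow> forall_M (X, f, Y) \<phi> \<in> Y \<rightarrow>\<^sub>E Pow A"
  by (fastforce simp: forall_M_def)

text \<open>Beck-Chevalley holds as an equality of functions: \<open>h'\<close> carries the fibre of
  \<open>f'\<close> over \<open>z\<close> onto the fibre of \<open>f\<close> over
  \<open>h z\<close>, so the two unions coincide.\<close>

lemma forall_M_pullback:
  assumes pb: "is_pullback (Sets U) (X, f, Y) (Z, h, Y) (D, h', X) (D, f', Z)"
  shows "forall_M (D, f', Z) (compose D \<phi> h') = compose Z (forall_M (X, f, Y) \<phi>) h"
proof
  fix z
  have h: "h \<in> Z \<rightarrow>\<^sub>E Y" using pb by (auto simp: is_pullback_def)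
  show "forall_M (D, f', Z) (compose D \<phi> h') z = compose Z (forall_M (X, f, Y) \<phi>) h z"
  proof (cases "z \<in> Z")
    case True
    then have hz: "h z \<in> Y" using h by blast
    have "forall_M (D, f', Z) (compose D \<phi> h') z = (\<Union>x\<in>h' ` {d \<in> D. f' d = z}. \<phi> x)"
      using True by (simp add: forall_M_def compose_eq)
    also have "\<dots> = (\<Union>x\<in>{x \<in> X. f x = h z}. \<phi> x)"
      by (simp only: pullback_fibres(1)[OF pb True])
    also have "\<dots> = compose Z (forall_M (X, f, Y) \<phi>) h z"
      using True hz by (simp add: forall_M_def compose_eq)
    finally show ?thesis .
  qed (simp add: compose_def forall_M_def)
qed

lemma full_universal_medvedev: "full_universal_doctrine (Sets U) (medvedev U A app A')"
  unfolding medvedev_def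
proof (rule M.full_universal_reflection[of forall_M])
  fix f X Y \<alpha> assume "f \<in> hom (Sets U) X Y" "\<alpha> \<in> elts M X"
  then show "forall_M f \<alpha> \<in> elts M Y"
    by (elim hom_SetsE) (simp add: forall_M_in)
next
  fix f X Y \<alpha> \<beta> assume "f \<in> hom (Sets U) X Y" and \<alpha>: "\<alpha> \<in> elts M X" and \<beta>: "\<beta> \<in> elts M Y"
  then obtain g where f: "f = (X, g, Y)" and g: "g \<in> X \<rightarrow>\<^sub>E Y" by (elim hom_SetsE)
  \<comment> \<open>For each fixed \<open>a\<close> the two conditions say the same thing, since
    every \<open>x\<close> lies in exactly one fibre; the adjunction thus keeps the
    realizer.\<close>
  have "(\<forall>x\<in>X. \<forall>b\<in>\<alpha> x. \<exists>c\<in>\<beta> (g x). app a b = Some c) \<longleftrightarrow>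
      (\<forall>y\<in>Y. \<forall>b\<in>forall_M (X, g, Y) \<alpha> y. \<exists>c\<in>\<beta> y. app a b = Some c)" for a
  proof (intro iffI ballI)
    fix y b assume *: "\<forall>x\<in>X. \<forall>b\<in>\<alpha> x. \<exists>c\<in>\<beta> (g x). app a b = Some c"
      and y: "y \<in> Y" and b: "b \<in> forall_M (X, g, Y) \<alpha> y"
    obtain x where "x \<in> X" "g x = y" "b \<in> \<alpha> x" using y b by (auto simp: forall_M_def)
    with * show "\<exists>c\<in>\<beta> y. app a b = Some c" by blast
  next
    fix x b assume *: "\<forall>y\<in>Y. \<forall>b\<in>forall_M (X, g, Y) \<alpha> y. \<exists>c\<in>\<beta> y. app a b = Some c"
      and x: "x \<in> X" and b: "b \<in> \<alpha> x"
    have "g x \<in> Y" using g x by blast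
    moreover from this have "b \<in> forall_M (X, g, Y) \<alpha> (g x)" using x b by (auto simp: forall_M_def)
    ultimately show "\<exists>c\<in>\<beta> (g x). app a b = Some c" using * by blast
  qed
  moreover have "compose X \<beta> g \<in> X \<rightarrow>\<^sub>E Pow A" using compose_PiE[OF g] \<beta> by simp
  ultimately show "(act M f \<beta>, \<alpha>) \<in> le M X \<longleftrightarrow> (\<beta>, forall_M f \<alpha>) \<in> le M Y"
    using \<alpha> \<beta> forall_M_in[OF g] by (simp add: f M_le_iff compose_eq)
next
  fix f h h' f' \<alpha> assume pb: "is_pullback (Sets U) f h h' f'" and \<alpha>: "\<alpha> \<in> elts M (source (Sets U) f)"
  then obtain X g Y Z k D k' g' where eqs: "f = (X, g, Y)" "h = (Z, k, Y)" "h' = (D, k', X)" "f' = (D, g', Z)"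
    by (cases f; cases h; cases h'; cases f') (auto simp: is_pullback_def)
  have "k \<in> Z \<rightarrow>\<^sub>E Y" "g \<in> X \<rightarrow>\<^sub>E Y" using pb by (auto simp: eqs is_pullback_def)
  then have "compose Z (forall_M (X, g, Y) \<alpha>) k \<in> Z \<rightarrow>\<^sub>E Pow A"
    using \<alpha> by (simp add: eqs compose_PiE forall_M_in)
  then show "(forall_M f' (act M h' \<alpha>), act M h (forall_M f \<alpha>)) \<in> equivalent M (source (Sets U) h)"
    using forall_M_pullback[of X g Y Z k D k' g'] pb M_le_refl by (simp add: eqs equivalent_def)
qed

section \<open>Comparison with the completion\<close>

abbreviation "K \<equiv> completion_pre (Sets U) (turing U A app A')"

definition rep :: "'u set \<Rightarrow> ('u \<Rightarrow> 'u) set \<Rightarrow> 'u \<Rightarrow> 'u" where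
  "rep Y c = (SOME \<alpha>. \<alpha> \<in> elts T Y \<and> c = eclass T Y \<alpha>)"

text \<open>Elements of \<open>K\<close> carry a Turing class, while \<open>fibre_values\<close>
  takes a function, so a representative is chosen; by \<open>fibre_values_equivalent\<close> the
  choice matters only up to equivalence.\<close>

definition comparison :: "'u set \<Rightarrow> 'u setmap \<times> ('u \<Rightarrow> 'u) set \<Rightarrow> 'u \<Rightarrow> 'u set" where
  "comparison X = (\<lambda>(f, c). fibre_values (f, rep (source (Sets U) f) c))"

lemma rep:
  assumes "c \<in> elts (turing U A app A') Y"
  shows "rep Y c \<in> Y \<rightarrow>\<^sub>E A" "eclass T Y (rep Y c) = c"
proof -
  have "\<exists>\<alpha>. \<alpha> \<in> elts T Y \<and> c = eclass T Y \<alpha>"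
    using assms by (auto simp: turing_def T.reflection_elts)
  from someI_ex[OF this] show "rep Y c \<in> Y \<rightarrow>\<^sub>E A" "eclass T Y (rep Y c) = c"
    by (simp_all add: rep_def)
qed

lemma eclass_in_turing: "\<alpha> \<in> Y \<rightarrow>\<^sub>E A \<Longrightarrow> eclass T Y \<alpha> \<in> elts (turing U A app A') Y"
  by (simp add: turing_def T.reflection_elts)

lemma rep_eclass:
  assumes Y: "Y \<in> U" and \<alpha>: "\<alpha> \<in> Y \<rightarrow>\<^sub>E A"
  shows "(rep Y (eclass T Y \<alpha>), \<alpha>) \<in> equivalent T Y"
proof -
  from rep[OF eclass_in_turing[OF \<alpha>]] show ?thesis using T.eclass_eq_iff[of Y] Y \<alpha> by simp
qed

lemma comparison_eclass:
  assumes "Y \<in> U" "f \<in> Y \<rightarrow>\<^sub>E X" "\<alpha> \<in> Y \<rightarrow>\<^sub>E A"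
  shows "(comparison X ((Y, f, X), eclass T Y \<alpha>), fibre_values ((Y, f, X), \<alpha>)) \<in> equivalent M X"
  using fibre_values_equivalent[OF assms(2) rep_eclass] assms
  by (simp add: comparison_def del: fibre_values.simps)

lemma K_eltsE:
  assumes "e \<in> elts K X"
  obtains Y f c where "e = ((Y, f, X), c)" "X \<in> U" "Y \<in> U" "f \<in> Y \<rightarrow>\<^sub>E X" "c \<in> elts (turing U A app A') Y"
  using assms by (auto simp: completion_pre_def)

lemma K_elts_iff:
  "((Y, f, X), c) \<in> elts K X \<longleftrightarrow> X \<in> U \<and> Y \<in> U \<and> f \<in> Y \<rightarrow>\<^sub>E X \<and> c \<in> elts (turing U A app A') Y"
  by (auto simp: completion_pre_def)

text \<open>Names the pullback hidden in the \<open>SOME\<close> of the completion. The choice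
  involves only the two underlying maps, so one square serves all classes \<open>c\<close>.\<close>

lemma K_act:
  assumes Y: "Y \<in> U" and X: "X \<in> U" and X': "X' \<in> U"
    and g: "g \<in> Y \<rightarrow>\<^sub>E X" and u: "u \<in> X' \<rightarrow>\<^sub>E X"
  obtains D p q where "is_pullback (Sets U) (X', u, X) (Y, g, X) (D, p, X') (D, q, Y)"
    and "\<forall>c. act K (X', u, X) ((Y, g, X), c) = ((D, p, X'), act (turing U A app A') (D, q, Y) c)"
proof -
  define s where "s = (SOME (p, q). is_pullback (Sets U) (X', u, X) (Y, g, X) p q)"
  obtain D0 p0 q0 where "is_pullback (Sets U) (X', u, X) (Y, g, X) (D0, p0, X') (D0, q0, Y)"
    by (rule exists_pullback[OF X' Y X u g])
  then have "case ((D0, p0, X'), (D0, q0, Y)) of (p, q) \<Rightarrow>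
      is_pullback (Sets U) (X', u, X) (Y, g, X) p q"
    by simp
  then have s: "case s of (p, q) \<Rightarrow> is_pullback (Sets U) (X', u, X) (Y, g, X) p q"
    unfolding s_def by (rule someI)
  obtain p q where pq: "s = (p, q)" by (cases s)
  with s obtain D p1 q1 where D: "p = (D, p1, X')" "q = (D, q1, Y)"
    by (cases p; cases q) (auto simp: is_pullback_def)
  have "act K (X', u, X) ((Y, g, X), c) = ((D, p1, X'), act (turing U A app A') (D, q1, Y) c)" for c
    using pq by (simp add: completion_pre_def flip: s_def) (simp add: D)
  then show ?thesis using that s pq D by simp
qed

text \<open>Naturality comes from \<open>fibre_values_pullback\<close>, the order from
  \<open>fibre_values_le_iff\<close> and surjectivity from \<open>fibre_values_surj\<close>. The
  preordered doctrine laws for \<open>K\<close> then follow from the general embedding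
  result.\<close>

sublocale K: indexed_equivalence "Sets U" M K comparison
proof
  fix X e e' assume "X \<in> obj (Sets U)" "(e, e') \<in> le K X"
  then show "e \<in> elts K X \<and> e' \<in> elts K X" by (auto simp: completion_pre_def)
next
  fix f X' X e assume "f \<in> hom (Sets U) X' X" and e: "e \<in> elts K X"
  then obtain u where f: "f = (X', u, X)" and X': "X' \<in> U" and X: "X \<in> U" and u: "u \<in> X' \<rightarrow>\<^sub>E X"
    by (elim hom_SetsE)
  obtain Y g c where e': "e = ((Y, g, X), c)" and Y: "Y \<in> U" and g: "g \<in> Y \<rightarrow>\<^sub>E X"
    and c: "c \<in> elts (turing U A app A') Y"
    using e by (elim K_eltsE)
  obtain D p q where pb: "is_pullback (Sets U) (X', u, X) (Y, g, X) (D, p, X') (D, q, Y)"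
    and act: "\<forall>c. act K (X', u, X) ((Y, g, X), c) = ((D, p, X'), act (turing U A app A') (D, q, Y) c)"
    by (rule K_act[OF Y X X' g u])
  have D: "D \<in> U" and p: "p \<in> D \<rightarrow>\<^sub>E X'" and q: "q \<in> D \<rightarrow>\<^sub>E Y" using pb by (auto simp: is_pullback_def)
  have qh: "(D, q, Y) \<in> hom (Sets U) D Y" using D Y q by simp
  note r = rep[OF c]
  have rq: "compose D (rep Y c) q \<in> D \<rightarrow>\<^sub>E A" using compose_PiE[OF q r(1)] .
  have "act (turing U A app A') (D, q, Y) c = eclass T D (compose D (rep Y c) q)"
    using T.reflection_act[OF qh, of "rep Y c"] r by (simp add: turing_def)
  then have act_e: "act K f e = ((D, p, X'), eclass T D (compose D (rep Y c) q))"
    by (simp add: f e' act)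
  show "act K f e \<in> elts K X'"
    unfolding act_e K_elts_iff using X' D p rq by (simp add: eclass_in_turing)
  \<comment> \<open>With the reindexed representative the equality is strict;
    \<open>comparison X'\<close> may pick another representative of the same class, hence only an
    equivalence follows.\<close>
  have "fibre_values ((D, p, X'), compose D (rep Y c) q) = act M f (comparison X e)"
    using fibre_values_pullback[OF pb] by (simp add: f e' comparison_def del: fibre_values.simps)
  then show "(comparison X' (act K f e), act M f (comparison X e)) \<in> equivalent M X'"
    using comparison_eclass[OF D p rq] by (simp add: act_e)
next
  fix X e assume "e \<in> elts K X"
  then show "comparison X e \<in> elts M X"
    by (elim K_eltsE) (simp add: comparison_def fibre_values_in rep(1) del: fibre_values.simps)
next
  fix X e e' assume X: "X \<in> obj (Sets U)" and e: "e \<in> elts K X" and e': "e' \<in> elts K X"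
  obtain Y f c where 1: "e = ((Y, f, X), c)" "Y \<in> U" "f \<in> Y \<rightarrow>\<^sub>E X" "c \<in> elts (turing U A app A') Y"
    using e by (elim K_eltsE)
  obtain Z g d where 2: "e' = ((Z, g, X), d)" "Z \<in> U" "g \<in> Z \<rightarrow>\<^sub>E X" "d \<in> elts (turing U A app A') Z"
    using e' by (elim K_eltsE)
  note r = rep[OF 1(4)] and r' = rep[OF 2(4)]
  show "(comparison X e, comparison X e') \<in> le M X \<longleftrightarrow> (e, e') \<in> le K X"
    \<comment> \<open>The order of \<open>K\<close> on classes is first reduced to chosen
      representatives, where the realizer argument applies.\<close>
    using fibre_values_le_iff[of X Y Z f "rep Y c" g "rep Z d"]
      T.completion_reflection_le_iff[of X "(Y, f, X)" "rep Y c" "(Z, g, X)" "rep Z d"]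
      X 1 2 r r'
    by (simp add: comparison_def turing_def del: fibre_values.simps)
next
  fix X \<phi> assume "X \<in> obj (Sets U)" and "\<phi> \<in> elts M X"
  then have X: "X \<in> U" and \<phi>: "\<phi> \<in> X \<rightarrow>\<^sub>E Pow A" by simp_all
  obtain Y f \<alpha> where "Y \<in> U" "f \<in> Y \<rightarrow>\<^sub>E X" "\<alpha> \<in> Y \<rightarrow>\<^sub>E A" "fibre_values ((Y, f, X), \<alpha>) = \<phi>"
    by (rule fibre_values_surj[OF X \<phi>])
  then show "\<exists>e\<in>elts K X. (comparison X e, \<phi>) \<in> equivalent M X"
    using X comparison_eclass[of Y f X \<alpha>]
    by (intro bexI[of _ "((Y, f, X), eclass T Y \<alpha>)"])
       (simp_all add: K_elts_iff eclass_in_turing del: fibre_values.simps)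
qed

text \<open>Full universality of the completion is obtained by transfer: the comparison gives an
  isomorphism of doctrines, and the quantifiers of the Medvedev doctrine are carried across
  it.\<close>

lemma medvedev_completion_iso:
  obtains \<theta> where "full_universal_iso (Sets U) (completion (Sets U) (turing U A app A'))
                (medvedev U A app A') \<theta>"
    and "\<And>X Y f \<alpha>. X \<in> U \<Longrightarrow> Y \<in> U \<Longrightarrow> f \<in> Y \<rightarrow>\<^sub>E X \<Longrightarrow> \<alpha> \<in> Y \<rightarrow>\<^sub>E A \<Longrightarrow>
      \<theta> X (eclass K X ((Y, f, X), eclass T Y \<alpha>)) = eclass M X (fibre_values ((Y, f, X), \<alpha>))"
proof -
  obtain \<theta> where iso: "doctrine_iso (Sets U) (poset_reflection (Sets U) K) (poset_reflection (Sets U) M) \<theta>"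
    and \<theta>: "\<forall>X\<in>obj (Sets U). \<forall>e\<in>elts K X. \<theta> X (eclass K X e) = eclass M X (comparison X e)"
    by (rule K.reflection_iso)
  have "full_universal_iso (Sets U) (completion (Sets U) (turing U A app A')) (medvedev U A app A') \<theta>"
    using full_universal_iso_transfer[OF full_universal_medvedev] iso
    by (simp add: completion_def medvedev_def)
  moreover have "\<theta> X (eclass K X ((Y, f, X), eclass T Y \<alpha>)) = eclass M X (fibre_values ((Y, f, X), \<alpha>))"
    if *: "X \<in> U" "Y \<in> U" "f \<in> Y \<rightarrow>\<^sub>E X" "\<alpha> \<in> Y \<rightarrow>\<^sub>E A" for X Y f \<alpha>
  proof -
    have "((Y, f, X), eclass T Y \<alpha>) \<in> elts K X"
      using * by (simp add: K_elts_iff eclass_in_turing)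
    then show ?thesis
      using \<theta> M.eclass_eq[OF _ comparison_eclass[OF *(2-4)]] *(1)
      by (simp del: fibre_values.simps)
  qed
  ultimately show ?thesis using that by blast
qed

section \<open>Surjectivity and order preservation on pairs of maps and functions, before passing to
  classes\<close>

lemma fibre_values_image:
  assumes X: "X \<in> U"
  shows "fibre_values ` elts (completion_pre (Sets U) T) X = elts M X"
proof
  show "fibre_values ` elts (completion_pre (Sets U) T) X \<subseteq> elts M X"
  proof (rule image_subsetI)
    fix e assume "e \<in> elts (completion_pre (Sets U) T) X"
    then obtain Y f \<alpha> where "e = ((Y, f, X), \<alpha>)" "f \<in> Y \<rightarrow>\<^sub>E X" "\<alpha> \<in> Y \<rightarrow>\<^sub>E A"
      by (auto simp: completion_pre_def)
    then show "fibre_values e \<in> elts M X"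
      by (simp only: M_simps fibre_values_in)
  qed
  show "elts M X \<subseteq> fibre_values ` elts (completion_pre (Sets U) T) X"
  proof
    fix \<phi> assume "\<phi> \<in> elts M X"
    then have \<phi>: "\<phi> \<in> X \<rightarrow>\<^sub>E Pow A" by simp
    obtain Y f \<alpha> where "Y \<in> U" "f \<in> Y \<rightarrow>\<^sub>E X" "\<alpha> \<in> Y \<rightarrow>\<^sub>E A" "fibre_values ((Y, f, X), \<alpha>) = \<phi>"
      by (rule fibre_values_surj[OF X \<phi>])
    then show "\<phi> \<in> fibre_values ` elts (completion_pre (Sets U) T) X"
      using X by (intro image_eqI[of _ _ "((Y, f, X), \<alpha>)"]) (auto simp: completion_pre_def)
  qed
qed

lemma fibre_values_hom:
  assumes le: "((f, \<alpha>), (g, \<beta>)) \<in> le (completion_pre (Sets U) T) X"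
  shows "(fibre_values (f, \<alpha>), fibre_values (g, \<beta>)) \<in> le M X"
proof -
  obtain Y f' Z g' where eqs: "f = (Y, f', X)" "g = (Z, g', X)"
    and *: "X \<in> U" "Y \<in> U" "Z \<in> U" "f' \<in> Y \<rightarrow>\<^sub>E X" "\<alpha> \<in> Y \<rightarrow>\<^sub>E A" "g' \<in> Z \<rightarrow>\<^sub>E X" "\<beta> \<in> Z \<rightarrow>\<^sub>E A"
    using le by (cases f; cases g) (auto simp: completion_pre_def)
  show ?thesis using fibre_values_le_iff[OF *] le by (simp add: eqs del: fibre_values.simps)
qed

end

theorem theorem4p7:
  fixes U :: "'u set set" and A A' :: "'u set" and app :: "'u \<Rightarrow> 'u \<Rightarrow> 'u option"
  assumes "set_universe U"
    and "A \<in> U"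
    and "pca A app"
    and "elementary_sub_pca A app A'"
  shows "(\<exists>\<theta>. full_universal_iso (Sets U) (completion (Sets U) (turing U A app A'))
                (medvedev U A app A') \<theta> \<and>
            (\<forall>X\<in>U. \<forall>Y\<in>U. \<forall>f \<in> Y \<rightarrow>\<^sub>E X. \<forall>\<alpha> \<in> Y \<rightarrow>\<^sub>E A.
               \<theta> X (eclass (completion_pre (Sets U) (turing U A app A')) X
                      ((Y, f, X), eclass (turing_pre A app A') Y \<alpha>))
               = eclass (medvedev_pre A app A') X (fibre_values ((Y, f, X), \<alpha>))))
       \<and> (\<forall>X\<in>U.
            fibre_values ` elts (completion_pre (Sets U) (turing_pre A app A')) X
              = elts (medvedev_pre A app A') X
          \<and> (\<forall>((f, \<alpha>), (g, \<beta>)) \<in> le (completion_pre (Sets U) (turing_pre A app A')) X.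
               (fibre_values (f, \<alpha>), fibre_values (g, \<beta>)) \<in> le (medvedev_pre A app A') X))"
proof -
  interpret small_pca U A app A'
    using assms by (simp add: small_pca_def small_pca_axioms_def)
  obtain \<theta> where "full_universal_iso (Sets U) (completion (Sets U) (turing U A app A'))
                (medvedev U A app A') \<theta>"
    and "\<And>X Y f \<alpha>. X \<in> U \<Longrightarrow> Y \<in> U \<Longrightarrow> f \<in> Y \<rightarrow>\<^sub>E X \<Longrightarrow> \<alpha> \<in> Y \<rightarrow>\<^sub>E A \<Longrightarrow>
      \<theta> X (eclass K X ((Y, f, X), eclass T Y \<alpha>)) = eclass M X (fibre_values ((Y, f, X), \<alpha>))"
    using medvedev_completion_iso by blast
  then show ?thesis
    using fibre_values_image fibre_values_hom by (intro conjI exI[of _ \<theta>] ballI) auto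
qed
end
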